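(* Let $p$ be a prime, let $e$ be a nonnegative integer, and let $G$ be a finite $p$-group with $p^{e+1}\mid |G|$. Let $I$ be the intersection of all subgroups of order $p^{e+1}$ in $G$. Then $$ |I\cap Z(G)|\le |\pi_0(\Gamma_{p,e}(G))|\le |\mathrm{Irr}(I)|. $$ In particular, $\Gamma_{p,e}(G)$ is connected if and only if $I=1$.
   Context: For a finite group $X$, $\mathrm{Irr}(X)$ denotes the set of irreducible complex characters of $X$, and $Z(X)$ its center. For a character $\varphi$ of $X$ and a subgroup $Y\le X$, $\varphi_Y$ denotes the restriction of $\varphi$ to $Y$, and $[\cdot,\cdot]$ denotes the usual inner product of class functions. For a finite group $G$, $\mathcal{S}_{p,e}(G)$ is the set of all $p$-subgroups of $G$ whose order is greater than $p^e$ (equivalently, at least $p^{e+1}$). Define $$\Gamma_{p,e}(G)=\{(H,\varphi)\mid H\in\mathcal{S}_{p,e}(G),\ \varphi\in\mathrm{Irr}(H)\},$$ partially ordered by $$(K,\psi)\le (H,\varphi)\iff K\le H \text{ and } [\varphi_K,\psi]\ne 0.$$ Two elements of $\Gamma_{p,e}(G)$ are connected (lie in the same connected component) if they can be joined by a finite sequence of elements of $\Gamma_{p,e}(G)$ in which every two consecutive elements are comparable under $\le$. The set of connected components is denoted by $\pi_0(\Gamma_{p,e}(G))$. The poset $\Gamma_{p,e}(G)$ is called connected if it has exactly one connected component. *)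

theory Defs
  imports
    "HOL-Algebra.Coset"
    "HOL-Computational_Algebra.Primes"
    "Jordan_Normal_Form.VS_Connect"
begin

section \<open>Irreducible complex characters\<close>

definition GL :: "nat \<Rightarrow> complex mat monoid" where
  "GL n = units_of (ring_mat TYPE(complex) n ())"

definition is_representation :: "('a, 'b) monoid_scheme \<Rightarrow> nat \<Rightarrow> ('a \<Rightarrow> complex mat) \<Rightarrow> bool" where
  "is_representation X n \<rho> \<longleftrightarrow> \<rho> \<in> hom X (GL n)"

definition invariant_subspace ::
    "('a, 'b) monoid_scheme \<Rightarrow> nat \<Rightarrow> ('a \<Rightarrow> complex mat) \<Rightarrow> complex vec set \<Rightarrow> bool" where
  "invariant_subspace X n \<rho> W \<longleftrightarrow>
     VectorSpace.subspace class_ring W (module_vec TYPE(complex) n) \<and>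
     (\<forall>x\<in>carrier X. \<forall>w\<in>W. \<rho> x *\<^sub>v w \<in> W)"

definition irreducible_representation ::
    "('a, 'b) monoid_scheme \<Rightarrow> nat \<Rightarrow> ('a \<Rightarrow> complex mat) \<Rightarrow> bool" where
  "irreducible_representation X n \<rho> \<longleftrightarrow>
     is_representation X n \<rho> \<and> n > 0 \<and>
     (\<forall>W. invariant_subspace X n \<rho> W \<longrightarrow> W = {0\<^sub>v n} \<or> W = carrier_vec n)"

definition mat_trace :: "complex mat \<Rightarrow> complex" where
  "mat_trace A = (\<Sum>i<dim_row A. A $$ (i, i))"

text \<open>Characters are extensional functions (\<open>undefined\<close> outside the carrier), so that
  equality of HOL functions is equality of functions on the group, and the restriction
  of a character to a subgroup \<open>Y\<close> is \<^term>\<open>restrict \<phi> Y\<close>.\<close>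

definition character_of :: "('a, 'b) monoid_scheme \<Rightarrow> ('a \<Rightarrow> complex mat) \<Rightarrow> 'a \<Rightarrow> complex" where
  "character_of X \<rho> = (\<lambda>x\<in>carrier X. mat_trace (\<rho> x))"

definition Irr :: "('a, 'b) monoid_scheme \<Rightarrow> ('a \<Rightarrow> complex) set" where
  "Irr X = {\<chi>. \<exists>n \<rho>. irreducible_representation X n \<rho> \<and> \<chi> = character_of X \<rho>}"

definition class_inner ::
    "('a, 'b) monoid_scheme \<Rightarrow> ('a \<Rightarrow> complex) \<Rightarrow> ('a \<Rightarrow> complex) \<Rightarrow> complex" where
  "class_inner X \<phi> \<psi> = (\<Sum>x\<in>carrier X. \<phi> x * cnj (\<psi> x)) / of_nat (Coset.order X)"

section \<open>The poset of pairs\<close>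

definition group_center :: "('a, 'b) monoid_scheme \<Rightarrow> 'a set" where
  "group_center G = {z \<in> carrier G. \<forall>g\<in>carrier G. z \<otimes>\<^bsub>G\<^esub> g = g \<otimes>\<^bsub>G\<^esub> z}"

definition is_p_group :: "nat \<Rightarrow> ('a, 'b) monoid_scheme \<Rightarrow> bool" where
  "is_p_group p X \<longleftrightarrow> group X \<and> finite (carrier X) \<and> (\<exists>n. Coset.order X = p ^ n)"

definition large_p_subgroups :: "nat \<Rightarrow> nat \<Rightarrow> ('a, 'b) monoid_scheme \<Rightarrow> 'a set set" where
  "large_p_subgroups p e G =
     {H. subgroup H G \<and> is_p_group p (G\<lparr>carrier := H\<rparr>) \<and> card H > p ^ e}"

definition Gamma :: "nat \<Rightarrow> nat \<Rightarrow> ('a, 'b) monoid_scheme \<Rightarrow> ('a set \<times> ('a \<Rightarrow> complex)) set" where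
  "Gamma p e G = (SIGMA H : large_p_subgroups p e G. Irr (G\<lparr>carrier := H\<rparr>))"

definition Gamma_le :: "('a, 'b) monoid_scheme \<Rightarrow>
    'a set \<times> ('a \<Rightarrow> complex) \<Rightarrow> 'a set \<times> ('a \<Rightarrow> complex) \<Rightarrow> bool" where
  "Gamma_le G = (\<lambda>(K, \<psi>) (H, \<phi>).
     K \<subseteq> H \<and> class_inner (G\<lparr>carrier := K\<rparr>) (restrict \<phi> K) \<psi> \<noteq> 0)"

definition Gamma_comparable :: "nat \<Rightarrow> nat \<Rightarrow> ('a, 'b) monoid_scheme \<Rightarrow>
    ('a set \<times> ('a \<Rightarrow> complex)) rel" where
  "Gamma_comparable p e G =
     {(a, b) \<in> Gamma p e G \<times> Gamma p e G. Gamma_le G a b \<or> Gamma_le G b a}"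

definition Gamma_linked :: "nat \<Rightarrow> nat \<Rightarrow> ('a, 'b) monoid_scheme \<Rightarrow>
    ('a set \<times> ('a \<Rightarrow> complex)) rel" where
  "Gamma_linked p e G =
     (Gamma_comparable p e G)\<^sup>* \<inter> (Gamma p e G \<times> Gamma p e G)"

definition pi0_Gamma :: "nat \<Rightarrow> nat \<Rightarrow> ('a, 'b) monoid_scheme \<Rightarrow>
    ('a set \<times> ('a \<Rightarrow> complex)) set set" where
  "pi0_Gamma p e G = Gamma p e G // Gamma_linked p e G"

definition Gamma_connected :: "nat \<Rightarrow> nat \<Rightarrow> ('a, 'b) monoid_scheme \<Rightarrow> bool" where
  "Gamma_connected p e G \<longleftrightarrow> card (pi0_Gamma p e G) = 1"

definition subgroups_inter :: "nat \<Rightarrow> nat \<Rightarrow> ('a, 'b) monoid_scheme \<Rightarrow> 'a set" where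
  "subgroups_inter p e G = \<Inter>{H. subgroup H G \<and> card H = p ^ (e + 1)}"

end

theory Submission
  imports
    Defs
    "Jordan_Normal_Form.Spectral_Radius"
    "Jordan_Normal_Form.DL_Rank"
    "HOL-Algebra.Sylow"
    "HOL-Algebra.Group_Action"
    "HOL-Algebra.Multiplicative_Group"
    "HOL-Library.Function_Algebras"
begin

text \<open>
  Fix a component \<open>P\<close> and let \<open>u\<^sub>P\<close> be the sum of \<open>\<chi>(1)\<chi>\<close> over the characters \<open>\<chi>\<close> of \<open>G\<close> with
  \<open>(G, \<chi>) \<in> P\<close>, which is a central idempotent of the group algebra up to a scalar. For every subgroup
  \<open>H\<close> of order \<open>p\<^sup>e\<^sup>+\<^sup>1\<close>, the characters of \<open>H\<close> in \<open>P\<close> give an idempotent of the group algebra of \<open>H\<close>,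
  and since no constituent relation crosses the boundary of \<open>P\<close>, the two idempotents coincide. Hence
  \<open>u\<^sub>P\<close> vanishes outside every such \<open>H\<close>, that is, outside \<open>I\<close>. The \<open>u\<^sub>P\<close> are linearly independent
  and lie in the span of the irreducible characters of \<open>I\<close>, which gives the upper bound.

  Conversely \<open>Z = I \<inter> Z(G)\<close> is contained in every member of the poset and acts on each irreducible
  character through a scalar character of \<open>Z\<close>, which is constant on components. Restricting the
  decomposition of the regular character to \<open>Z\<close> shows that these scalar characters span all
  functions on \<open>Z\<close>, so there are at least \<open>|Z|\<close> components. Finally, a nontrivial normal subgroup
  of a \<open>p\<close>-group meets the center nontrivially.
\<close>

text \<open>Every pair \<open>(H, \<phi>)\<close> lies below some \<open>(G, \<chi>)\<close>,
  because \<open>\<phi>\<close> occurs in the restricted regular character of \<open>G\<close>.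
  Hence the components amount to a partition of \<open>Irr G\<close>, and each one can be
  represented by a character of \<open>G\<close>. The obstacle is that incomparability of
  \<open>(H, \<phi>)\<close> and \<open>(G, \<chi>)\<close> only says that one number, an inner
  product, is zero, whereas comparing the idempotents needs the whole product of
  \<open>\<chi>\<close> with the zero extension of \<open>\<phi>\<close> to vanish. Positivity
  closes the gap: that product has a squared norm proportional to the number in question. For this
  reason the argument is carried out with functions under convolution. Both bounds are then the same
  rank argument: an invertible diagonal matrix factors through a smaller index set. For the upper
  bound it is indexed by components and factors through \<open>Irr\<close> of \<open>I\<close>; for
  the lower bound it is indexed by \<open>I \<inter> group_center G\<close> and factors through
  components. The factor \<open>Coset.order G\<close> on the diagonals comes from character
  convolution and from the regular character.\<close>

lemma index_mult_mat_sum: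
  assumes "A \<in> carrier_mat n m" "B \<in> carrier_mat m k" "i < n" "j < k"
  shows "(A * B) $$ (i, j) = (\<Sum>t<m. A $$ (i, t) * B $$ (t, j))"
  using assms by (auto simp: scalar_prod_def atLeast0LessThan intro!: sum.cong)

lemma mat_trace_mult_commute:
  assumes A: "A \<in> carrier_mat n m" and B: "B \<in> carrier_mat m n"
  shows "mat_trace (A * B) = mat_trace (B * A)"
proof -
  have "mat_trace (A * B) = (\<Sum>i<n. \<Sum>t<m. A $$ (i, t) * B $$ (t, i))"
    unfolding mat_trace_def using A B by (auto intro!: sum.cong simp del: index_mult_mat(1) simp: index_mult_mat_sum)
  also have "\<dots> = (\<Sum>t<m. \<Sum>i<n. B $$ (t, i) * A $$ (i, t))"
    by (subst sum.swap) (simp add: mult.commute)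
  also have "\<dots> = mat_trace (B * A)"
    unfolding mat_trace_def using A B by (auto intro!: sum.cong simp del: index_mult_mat(1) simp: index_mult_mat_sum)
  finally show ?thesis .
qed

lemma mat_trace_one: "mat_trace (1\<^sub>m n) = of_nat n"
  by (simp add: mat_trace_def)

lemma mat_trace_similar:
  assumes A: "A \<in> carrier_mat n n" and sim: "similar_mat_wit A B P Q"
  shows "mat_trace A = mat_trace B"
proof -
  note D = similar_mat_witD2[OF A sim]
  note c = D(4-7)
  have "mat_trace A = mat_trace (P * (B * Q))"
    using assoc_mult_mat[OF c(3,2,4)] D(3) by simp
  also have "\<dots> = mat_trace ((B * Q) * P)"
    by (rule mat_trace_mult_commute[of _ n n]) (use c in auto)
  also have "(B * Q) * P = B"
    using assoc_mult_mat[OF c(2,4,3)] D(2) c(2) by simp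
  finally show ?thesis .
qed

lemma eq_mat_mult_vecI:
  fixes A B :: "'a :: semiring_1 mat"
  assumes A: "A \<in> carrier_mat n m" and B: "B \<in> carrier_mat n m"
    and eq: "\<And>v. v \<in> carrier_vec m \<Longrightarrow> A *\<^sub>v v = B *\<^sub>v v"
  shows "A = B"
proof (rule eq_matI)
  fix i j assume ij: "i < dim_row B" "j < dim_col B"
  have "row C i \<bullet> unit_vec m j = C $$ (i, j)" if "C \<in> carrier_mat n m" for C :: "'a mat"
    using that A B ij by auto
  moreover have "(A *\<^sub>v unit_vec m j) $ i = (B *\<^sub>v unit_vec m j) $ i"
    using eq[of "unit_vec m j"] by simp
  ultimately show "A $$ (i, j) = B $$ (i, j)"
    using A B ij by simp
qed (use A B in auto)

section \<open>Representations and Schur's lemma\<close>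

text \<open>Invertibility comes for free, since \<open>\<rho> (inv x)\<close> is a two-sided inverse
  of \<open>\<rho> x\<close>. The right-hand side is the form in which matrix constructions are
  later recognized as representations.\<close>

lemma is_representation_iff:
  assumes X: "group X"
  shows "is_representation X n \<rho> \<longleftrightarrow>
    (\<forall>x\<in>carrier X. \<rho> x \<in> carrier_mat n n) \<and> \<rho> \<one>\<^bsub>X\<^esub> = 1\<^sub>m n \<and>
    (\<forall>x\<in>carrier X. \<forall>y\<in>carrier X. \<rho> (x \<otimes>\<^bsub>X\<^esub> y) = \<rho> x * \<rho> y)" (is "?L \<longleftrightarrow> ?R")
proof
  interpret X: group X by fact
  interpret R: ring "ring_mat TYPE(complex) n ()" by (rule ring_mat)
  have GL: "group (GL n)" unfolding GL_def by (rule R.units_group)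
  show ?R if ?L
  proof -
    have h: "\<rho> \<in> hom X (GL n)" using that by (simp add: is_representation_def)
    have "\<rho> \<one>\<^bsub>X\<^esub> = \<one>\<^bsub>GL n\<^esub>"
      using X GL h by (simp add: hom_one)
    then show ?thesis
      using h by (auto simp: hom_def GL_def units_of_def Units_def ring_mat_simps Pi_def)
  qed
  show ?L if R: ?R
  proof -
    have "\<rho> x \<in> Units (ring_mat TYPE(complex) n ())" if "x \<in> carrier X" for x
    proof -
      have "\<rho> (inv\<^bsub>X\<^esub> x) * \<rho> x = 1\<^sub>m n" "\<rho> x * \<rho> (inv\<^bsub>X\<^esub> x) = 1\<^sub>m n"
        using R that by (metis X.inv_closed X.l_inv X.r_inv)+
      moreover have "\<rho> (inv\<^bsub>X\<^esub> x) \<in> carrier_mat n n" "\<rho> x \<in> carrier_mat n n"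
        using R that by auto
      ultimately show ?thesis
        by (auto simp: Units_def ring_mat_simps)
    qed
    then show ?thesis
      using R by (auto simp: is_representation_def hom_def GL_def units_of_def ring_mat_simps)
  qed
qed

lemma
  assumes "is_representation X n \<rho>" "group X"
  shows representation_carrier: "x \<in> carrier X \<Longrightarrow> \<rho> x \<in> carrier_mat n n"
    and representation_one: "\<rho> \<one>\<^bsub>X\<^esub> = 1\<^sub>m n"
    and representation_mult:
      "x \<in> carrier X \<Longrightarrow> y \<in> carrier X \<Longrightarrow> \<rho> (x \<otimes>\<^bsub>X\<^esub> y) = \<rho> x * \<rho> y"
  using assms by (auto simp: is_representation_iff)

lemma irreducible_imp_representation:
  "irreducible_representation X n \<rho> \<Longrightarrow> is_representation X n \<rho>"
  by (simp add: irreducible_representation_def)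

lemma invariant_subspaceI:
  assumes "W \<subseteq> carrier_vec n" "0\<^sub>v n \<in> W"
    and "\<And>v w. v \<in> W \<Longrightarrow> w \<in> W \<Longrightarrow> v + w \<in> W"
    and "\<And>c v. v \<in> W \<Longrightarrow> c \<cdot>\<^sub>v v \<in> W"
    and "\<And>x w. x \<in> carrier X \<Longrightarrow> w \<in> W \<Longrightarrow> \<rho> x *\<^sub>v w \<in> W"
  shows "invariant_subspace X n \<rho> W"
  unfolding invariant_subspace_def VectorSpace.subspace_def LinearCombinations.submodule_def
  using assms by (auto simp: module_vec_simps vec_vs vec_module)

lemma intertwiner_kernel_invariant:
  assumes X: "group X" and \<sigma>: "is_representation X m \<sigma>" and \<rho>: "is_representation X n \<rho>"
    and M: "M \<in> carrier_mat n m" and MI: "\<And>x. x \<in> carrier X \<Longrightarrow> \<rho> x * M = M * \<sigma> x"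
  shows "invariant_subspace X m \<sigma> {v \<in> carrier_vec m. M *\<^sub>v v = 0\<^sub>v n}"
proof (rule invariant_subspaceI; clarsimp)
  show "M *\<^sub>v 0\<^sub>v m = 0\<^sub>v n" using M by auto
next
  fix v w :: "complex vec"
  assume "v \<in> carrier_vec m" "w \<in> carrier_vec m" "M *\<^sub>v v = 0\<^sub>v n" "M *\<^sub>v w = 0\<^sub>v n"
  then show "M *\<^sub>v (v + w) = 0\<^sub>v n"
    using M by (simp add: mult_add_distrib_mat_vec)
next
  fix v :: "complex vec" and c
  assume "v \<in> carrier_vec m" "M *\<^sub>v v = 0\<^sub>v n"
  then show "M *\<^sub>v (c \<cdot>\<^sub>v v) = 0\<^sub>v n"
    using M by (simp add: mult_mat_vec) (rule eq_vecI; simp)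
next
  fix x and v :: "complex vec"
  assume x: "x \<in> carrier X" and v: "v \<in> carrier_vec m" "M *\<^sub>v v = 0\<^sub>v n"
  have s: "\<sigma> x \<in> carrier_mat m m" "\<rho> x \<in> carrier_mat n n"
    using representation_carrier[OF \<sigma> X x] representation_carrier[OF \<rho> X x] by auto
  have "M *\<^sub>v (\<sigma> x *\<^sub>v v) = \<rho> x *\<^sub>v (M *\<^sub>v v)"
    using assoc_mult_mat_vec[OF M s(1) v(1)] assoc_mult_mat_vec[OF s(2) M v(1)] MI[OF x] by simp
  then show "\<sigma> x *\<^sub>v v \<in> carrier_vec m \<and> M *\<^sub>v (\<sigma> x *\<^sub>v v) = 0\<^sub>v n"
    using v s by auto
qed

lemma intertwiner_image_invariant:
  assumes X: "group X" and \<sigma>: "is_representation X m \<sigma>" and \<rho>: "is_representation X n \<rho>"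
    and M: "M \<in> carrier_mat n m" and MI: "\<And>x. x \<in> carrier X \<Longrightarrow> \<rho> x * M = M * \<sigma> x"
  shows "invariant_subspace X n \<rho> ((\<lambda>v. M *\<^sub>v v) ` carrier_vec m)"
proof (rule invariant_subspaceI)
  show "(\<lambda>v. M *\<^sub>v v) ` carrier_vec m \<subseteq> carrier_vec n" using M by auto
  show "0\<^sub>v n \<in> (\<lambda>v. M *\<^sub>v v) ` carrier_vec m"
    by (rule image_eqI[of _ _ "0\<^sub>v m"]) (use M in auto)
next
  fix v w assume "v \<in> (\<lambda>v. M *\<^sub>v v) ` carrier_vec m" "w \<in> (\<lambda>v. M *\<^sub>v v) ` carrier_vec m"
  then obtain a b where "a \<in> carrier_vec m" "b \<in> carrier_vec m" "v = M *\<^sub>v a" "w = M *\<^sub>v b"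
    by auto
  then show "v + w \<in> (\<lambda>v. M *\<^sub>v v) ` carrier_vec m"
    using M by (intro image_eqI[of _ _ "a + b"]) (auto simp: mult_add_distrib_mat_vec)
next
  fix c v assume "v \<in> (\<lambda>v. M *\<^sub>v v) ` carrier_vec m"
  then obtain a where "a \<in> carrier_vec m" "v = M *\<^sub>v a"
    by auto
  then show "c \<cdot>\<^sub>v v \<in> (\<lambda>v. M *\<^sub>v v) ` carrier_vec m"
    using M by (intro image_eqI[of _ _ "c \<cdot>\<^sub>v a"]) (auto simp: mult_mat_vec)
next
  fix x w assume x: "x \<in> carrier X" and "w \<in> (\<lambda>v. M *\<^sub>v v) ` carrier_vec m"
  then obtain a where a: "a \<in> carrier_vec m" "w = M *\<^sub>v a"
    by auto
  have s: "\<sigma> x \<in> carrier_mat m m" "\<rho> x \<in> carrier_mat n n"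
    using representation_carrier[OF \<sigma> X x] representation_carrier[OF \<rho> X x] by auto
  have "\<rho> x *\<^sub>v w = M *\<^sub>v (\<sigma> x *\<^sub>v a)"
    using assoc_mult_mat_vec[OF M s(1) a(1)] assoc_mult_mat_vec[OF s(2) M a(1)] MI[OF x] a by simp
  then show "\<rho> x *\<^sub>v w \<in> (\<lambda>v. M *\<^sub>v v) ` carrier_vec m"
    using s a by auto
qed

text \<open>Kernel and image of \<open>M\<close> are invariant, so irreducibility on both sides
  makes a nonzero \<open>M\<close> injective and surjective.\<close>

lemma Schur_lemma:
  assumes X: "group X" and \<rho>: "irreducible_representation X n \<rho>"
    and \<sigma>: "irreducible_representation X m \<sigma>"
    and M: "M \<in> carrier_mat n m" and MI: "\<And>x. x \<in> carrier X \<Longrightarrow> \<rho> x * M = M * \<sigma> x"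
    and nz: "M \<noteq> 0\<^sub>m n m"
  obtains N where "n = m" "N \<in> carrier_mat n n" "M * N = 1\<^sub>m n" "N * M = 1\<^sub>m n"
proof -
  note rep = irreducible_imp_representation[OF \<rho>] irreducible_imp_representation[OF \<sigma>]
  let ?K = "{v \<in> carrier_vec m. M *\<^sub>v v = 0\<^sub>v n}" and ?I = "(\<lambda>v. M *\<^sub>v v) ` carrier_vec m"
  obtain u where u: "u \<in> carrier_vec m" "M *\<^sub>v u \<noteq> 0\<^sub>v n"
  proof (rule ccontr)
    assume "\<not> thesis"
    with that have "M *\<^sub>v v = 0\<^sub>v n" if "v \<in> carrier_vec m" for v using that by blast
    then have "M = 0\<^sub>m n m"
      by (intro eq_mat_mult_vecI[OF M]) auto
    with nz show False by simp
  qed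
  have "?K = {0\<^sub>v m} \<or> ?K = carrier_vec m"
    using intertwiner_kernel_invariant[OF X rep(2,1) M MI] \<sigma>
    unfolding irreducible_representation_def by blast
  with u have K: "?K = {0\<^sub>v m}" by blast
  have "?I = {0\<^sub>v n} \<or> ?I = carrier_vec n"
    using intertwiner_image_invariant[OF X rep(2,1) M MI] \<rho>
    unfolding irreducible_representation_def by blast
  with u have I: "?I = carrier_vec n" by blast
  have "\<exists>w. w \<in> carrier_vec m \<and> M *\<^sub>v w = unit_vec n j" for j
  proof -
    have "unit_vec n j \<in> ?I" unfolding I by simp
    then show ?thesis by force
  qed
  then obtain f where f: "\<And>j. f j \<in> carrier_vec m" "\<And>j. M *\<^sub>v f j = unit_vec n j"
    by metis
  \<comment> \<open>Column \<open>j\<close> of \<open>N\<close> is a chosen preimage of the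
    \<open>j\<close>-th unit vector, which makes \<open>N\<close> a right inverse.\<close>
  define N where "N = mat m n (\<lambda>(i, j). f j $ i)"
  have N: "N \<in> carrier_mat m n" by (simp add: N_def)
  have colN: "col N j = f j" if "j < n" for j
    using that f(1)[of j] by (auto simp: N_def col_def intro!: eq_vecI)
  have MN: "M * N = 1\<^sub>m n"
  proof (rule eq_matI)
    fix i j assume "i < dim_row (1\<^sub>m n :: complex mat)" "j < dim_col (1\<^sub>m n :: complex mat)"
    then have ij: "i < n" "j < n" by auto
    have "(M * N) $$ (i, j) = (M *\<^sub>v f j) $ i"
      using ij M N colN by simp
    also have "\<dots> = 1\<^sub>m n $$ (i, j)"
      using f(2)[of j] ij by auto
    finally show "(M * N) $$ (i, j) = 1\<^sub>m n $$ (i, j)" .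
  qed (use M N in auto)
  \<comment> \<open>Since the kernel of \<open>M\<close> is zero, it suffices to compare images
    under \<open>M\<close>: applying \<open>M\<close> after \<open>N * M\<close> agrees with
    applying \<open>M\<close>, by \<open>MN\<close>.\<close>
  have NM: "N * M = 1\<^sub>m m"
  proof (rule eq_mat_mult_vecI)
    fix v :: "complex vec" assume v: "v \<in> carrier_vec m"
    have c: "(N * M) *\<^sub>v v \<in> carrier_vec m" using M N v by auto
    have "M *\<^sub>v ((N * M) *\<^sub>v v) = (M * N) *\<^sub>v (M *\<^sub>v v)"
      using M N v by (metis assoc_mult_mat_vec mult_carrier_mat mult_mat_vec_carrier)
    also have "\<dots> = M *\<^sub>v v"
      using M v by (simp add: MN)
    finally have "M *\<^sub>v ((N * M) *\<^sub>v v - v) = 0\<^sub>v n"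
      using mult_minus_distrib_mat_vec[OF M c v] M v by simp
    then have "(N * M) *\<^sub>v v - v \<in> ?K"
      using c v by auto
    then have "(N * M) *\<^sub>v v - v = 0\<^sub>v m"
      unfolding K by simp
    then have "(N * M) *\<^sub>v v = v"
      using c v by (metis carrier_vecD eq_iff_diff_eq_0 eq_vecI index_minus_vec(1) index_zero_vec(1))
    then show "N * M *\<^sub>v v = 1\<^sub>m m *\<^sub>v v" using v by simp
  qed (use M N in auto)
  \<comment> \<open>The degrees are the traces of \<open>M * N\<close> and \<open>N * M\<close>,
    which agree.\<close>
  have "of_nat n = (of_nat m :: complex)"
    using mat_trace_mult_commute[OF M N] MN NM by (simp add: mat_trace_one)
  then have "n = m" by simp
  then show thesis
    using that N MN NM by auto
qed

text \<open>For an eigenvalue \<open>c\<close> of \<open>T\<close>, the intertwiner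
  \<open>T - c\<close> kills an eigenvector, so it is not invertible and must be zero.\<close>

lemma Schur_scalar:
  assumes X: "group X" and \<rho>: "irreducible_representation X n \<rho>"
    and T: "T \<in> carrier_mat n n" and TI: "\<And>x. x \<in> carrier X \<Longrightarrow> \<rho> x * T = T * \<rho> x"
  obtains c where "T = c \<cdot>\<^sub>m 1\<^sub>m n"
proof -
  have n: "n > 0" using \<rho> by (simp add: irreducible_representation_def)
  note rep = irreducible_imp_representation[OF \<rho>]
  obtain c v where v: "v \<in> carrier_vec n" "v \<noteq> 0\<^sub>v n" "T *\<^sub>v v = c \<cdot>\<^sub>v v"
    using spectrum_non_empty[OF T n] T by (auto simp: spectrum_def eigenvalue_def eigenvector_def)
  define M where "M = T + (- c) \<cdot>\<^sub>m 1\<^sub>m n"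
  have M: "M \<in> carrier_mat n n" using T by (simp add: M_def)
  have c1: "(- c) \<cdot>\<^sub>m 1\<^sub>m n \<in> carrier_mat n n" by simp
  have MI: "\<rho> x * M = M * \<rho> x" if x: "x \<in> carrier X" for x
  proof -
    have R: "\<rho> x \<in> carrier_mat n n" using representation_carrier[OF rep X x] .
    have "\<rho> x * M = \<rho> x * T + \<rho> x * ((- c) \<cdot>\<^sub>m 1\<^sub>m n)"
      unfolding M_def by (rule mult_add_distrib_mat[OF R T c1])
    also have "\<dots> = T * \<rho> x + ((- c) \<cdot>\<^sub>m 1\<^sub>m n) * \<rho> x"
      using R TI[OF x] mult_smult_distrib[OF R one_carrier_mat, of "- c"]
        mult_smult_assoc_mat[OF one_carrier_mat R, of "- c"] by simp
    also have "\<dots> = M * \<rho> x"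
      unfolding M_def by (rule add_mult_distrib_mat[OF T c1 R, symmetric])
    finally show ?thesis .
  qed
  have "((- c) \<cdot>\<^sub>m 1\<^sub>m n) *\<^sub>v v = (- c) \<cdot>\<^sub>v v"
    by (rule eq_vecI) (use v in auto)
  then have Mv: "M *\<^sub>v v = 0\<^sub>v n"
    using v by (simp add: M_def add_mult_distrib_mat_vec[OF T c1 v(1)]) (rule eq_vecI; simp)
  have "M = 0\<^sub>m n n"
  proof (rule ccontr)
    assume "M \<noteq> 0\<^sub>m n n"
    then obtain N where N: "N \<in> carrier_mat n n" "N * M = 1\<^sub>m n"
      using Schur_lemma[OF X \<rho> \<rho> M MI] by blast
    have "v = (N * M) *\<^sub>v v" using N v by simp
    also have "\<dots> = N *\<^sub>v (M *\<^sub>v v)" by (rule assoc_mult_mat_vec[OF N(1) M v(1)])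
    also have "\<dots> = 0\<^sub>v n" using Mv N by auto
    finally show False using v by simp
  qed
  have "T = c \<cdot>\<^sub>m 1\<^sub>m n"
  proof (rule eq_matI)
    fix i j assume "i < dim_row (c \<cdot>\<^sub>m 1\<^sub>m n)" "j < dim_col (c \<cdot>\<^sub>m 1\<^sub>m n)"
    then have ij: "i < n" "j < n" by auto
    have "M $$ (i, j) = 0" using \<open>M = 0\<^sub>m n n\<close> ij by simp
    then show "T $$ (i, j) = (c \<cdot>\<^sub>m 1\<^sub>m n) $$ (i, j)"
      using ij T by (simp add: M_def)
  qed (use T in auto)
  then show thesis by (rule that)
qed

text \<open>The matrix \<open>\<Sum>\<^sub>x \<rho>(x) E\<^sub>j\<^sub>k \<sigma>(x\<inverse>)\<close> for the elementary matrix \<open>E\<^sub>j\<^sub>k\<close>.\<close>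

definition averaged_mat ::
    "('a, 'b) monoid_scheme \<Rightarrow> nat \<Rightarrow> ('a \<Rightarrow> complex mat) \<Rightarrow> nat \<Rightarrow> ('a \<Rightarrow> complex mat)
      \<Rightarrow> nat \<Rightarrow> nat \<Rightarrow> complex mat" where
  "averaged_mat X n \<rho> m \<sigma> j k =
     mat n m (\<lambda>(i, l). \<Sum>x\<in>carrier X. \<rho> x $$ (i, j) * \<sigma> (inv\<^bsub>X\<^esub> x) $$ (k, l))"

text \<open>Multiplying by \<open>\<rho> g\<close> on the left replaces \<open>x\<close> by
  \<open>g x\<close> in the first factor. Renaming \<open>y = g x\<close> turns \<open>inv x\<close>
  into \<open>inv y\<close> times \<open>g\<close>, and \<open>\<sigma> g\<close> splits off on the
  right.\<close>

lemma averaged_mat_intertwiner: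
  assumes X: "group X" "finite (carrier X)"
    and \<rho>: "is_representation X n \<rho>" and \<sigma>: "is_representation X m \<sigma>"
    and jk: "j < n" "k < m" and g: "g \<in> carrier X"
  shows "\<rho> g * averaged_mat X n \<rho> m \<sigma> j k = averaged_mat X n \<rho> m \<sigma> j k * \<sigma> g"
    (is "_ * ?T = _")
proof -
  interpret X: group X by fact
  have T: "?T \<in> carrier_mat n m" by (simp add: averaged_mat_def)
  have R: "\<rho> x \<in> carrier_mat n n" "\<sigma> x \<in> carrier_mat m m" if "x \<in> carrier X" for x
    using representation_carrier[OF \<rho> X(1)] representation_carrier[OF \<sigma> X(1)] that by auto
  show ?thesis
  proof (rule eq_matI)
    fix i l assume "i < dim_row (?T * \<sigma> g)" "l < dim_col (?T * \<sigma> g)"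
    then have il: "i < n" "l < m" using R(2)[OF g] by (auto simp: averaged_mat_def)
    have "(\<rho> g * ?T) $$ (i, l) = (\<Sum>a<n. \<rho> g $$ (i, a) * ?T $$ (a, l))"
      by (rule index_mult_mat_sum[OF R(1)[OF g] T il])
    also have "\<dots> = (\<Sum>a<n. \<rho> g $$ (i, a) * (\<Sum>x\<in>carrier X. \<rho> x $$ (a, j) * \<sigma> (inv\<^bsub>X\<^esub> x) $$ (k, l)))"
      using il by (simp add: averaged_mat_def)
    also have "\<dots> = (\<Sum>x\<in>carrier X. (\<Sum>a<n. \<rho> g $$ (i, a) * \<rho> x $$ (a, j)) * \<sigma> (inv\<^bsub>X\<^esub> x) $$ (k, l))"
      by (simp add: sum_distrib_left sum_distrib_right mult.assoc sum.swap[of _ "carrier X"])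
    also have "\<dots> = (\<Sum>x\<in>carrier X. \<rho> (g \<otimes>\<^bsub>X\<^esub> x) $$ (i, j) * \<sigma> (inv\<^bsub>X\<^esub> x) $$ (k, l))"
    proof (rule sum.cong[OF refl])
      fix x assume x: "x \<in> carrier X"
      show "(\<Sum>a<n. \<rho> g $$ (i, a) * \<rho> x $$ (a, j)) * \<sigma> (inv\<^bsub>X\<^esub> x) $$ (k, l)
        = \<rho> (g \<otimes>\<^bsub>X\<^esub> x) $$ (i, j) * \<sigma> (inv\<^bsub>X\<^esub> x) $$ (k, l)"
        using representation_mult[OF \<rho> X(1) g x] index_mult_mat_sum[OF R(1)[OF g] R(1)[OF x] il(1) jk(1)]
        by simp
    qed
    also have "\<dots> = (\<Sum>y\<in>carrier X. \<rho> y $$ (i, j) * \<sigma> (inv\<^bsub>X\<^esub> y \<otimes>\<^bsub>X\<^esub> g) $$ (k, l))"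
      by (rule sum.reindex_bij_witness[of _ "\<lambda>y. inv\<^bsub>X\<^esub> g \<otimes>\<^bsub>X\<^esub> y" "\<lambda>x. g \<otimes>\<^bsub>X\<^esub> x"])
        (use g in \<open>auto simp: X.inv_mult_group X.m_assoc X.inv_solve_left X.m_assoc[symmetric]\<close>)
    also have "\<dots> = (\<Sum>x\<in>carrier X. \<rho> x $$ (i, j) * (\<Sum>a<m. \<sigma> (inv\<^bsub>X\<^esub> x) $$ (k, a) * \<sigma> g $$ (a, l)))"
    proof (rule sum.cong[OF refl])
      fix x assume "x \<in> carrier X"
      then have x: "inv\<^bsub>X\<^esub> x \<in> carrier X" by simp
      show "\<rho> x $$ (i, j) * \<sigma> (inv\<^bsub>X\<^esub> x \<otimes>\<^bsub>X\<^esub> g) $$ (k, l)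
        = \<rho> x $$ (i, j) * (\<Sum>a<m. \<sigma> (inv\<^bsub>X\<^esub> x) $$ (k, a) * \<sigma> g $$ (a, l))"
        using representation_mult[OF \<sigma> X(1) x g] index_mult_mat_sum[OF R(2)[OF x] R(2)[OF g] jk(2) il(2)]
        by simp
    qed
    also have "\<dots> = (\<Sum>a<m. (\<Sum>x\<in>carrier X. \<rho> x $$ (i, j) * \<sigma> (inv\<^bsub>X\<^esub> x) $$ (k, a)) * \<sigma> g $$ (a, l))"
      by (simp add: sum_distrib_left sum_distrib_right mult.assoc sum.swap[of _ "carrier X"])
    also have "\<dots> = (\<Sum>a<m. ?T $$ (i, a) * \<sigma> g $$ (a, l))"
      using il by (simp add: averaged_mat_def)
    also have "\<dots> = (?T * \<sigma> g) $$ (i, l)"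
      by (rule index_mult_mat_sum[OF T R(2)[OF g] il, symmetric])
    finally show "(\<rho> g * ?T) $$ (i, l) = (?T * \<sigma> g) $$ (i, l)" .
  qed (use T R[OF g] in auto)
qed

text \<open>A nonzero averaged matrix would be invertible by \<open>Schur_lemma\<close>, so
  \<open>\<rho>\<close> and \<open>\<sigma>\<close> would be conjugate and have equal characters.
  The sum in question is an entry of that matrix.\<close>

lemma matrix_entries_orthogonal:
  assumes X: "group X" "finite (carrier X)"
    and \<rho>: "irreducible_representation X n \<rho>" and \<sigma>: "irreducible_representation X m \<sigma>"
    and ne: "character_of X \<rho> \<noteq> character_of X \<sigma>"
    and ix: "i < n" "j < n" "k < m" "l < m"
  shows "(\<Sum>x\<in>carrier X. \<rho> x $$ (i, j) * \<sigma> (inv\<^bsub>X\<^esub> x) $$ (k, l)) = 0"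
proof -
  note rep = irreducible_imp_representation[OF \<rho>] irreducible_imp_representation[OF \<sigma>]
  let ?T = "averaged_mat X n \<rho> m \<sigma> j k"
  have T: "?T \<in> carrier_mat n m" by (simp add: averaged_mat_def)
  note TI = averaged_mat_intertwiner[OF X rep ix(2,3)]
  have "?T = 0\<^sub>m n m"
  proof (rule ccontr)
    assume "?T \<noteq> 0\<^sub>m n m"
    then obtain N where N: "n = m" "N \<in> carrier_mat n n" "?T * N = 1\<^sub>m n" "N * ?T = 1\<^sub>m n"
      using Schur_lemma[OF X(1) \<rho> \<sigma> T TI] by blast
    have "mat_trace (\<rho> x) = mat_trace (\<sigma> x)" if x: "x \<in> carrier X" for x
    proof -
      have R: "\<rho> x \<in> carrier_mat n n" "\<sigma> x \<in> carrier_mat n n"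
        using representation_carrier[OF rep(1) X(1) x] representation_carrier[OF rep(2) X(1) x] N(1) by auto
      have T': "?T \<in> carrier_mat n n" using T N(1) by simp
      have "\<rho> x = \<rho> x * (?T * N)" using N R by simp
      also have "\<dots> = ?T * \<sigma> x * N" using TI[OF x] assoc_mult_mat[OF R(1) T' N(2)] by simp
      finally have "mat_trace (\<rho> x) = mat_trace (?T * \<sigma> x * N)" by simp
      also have "\<dots> = mat_trace (N * (?T * \<sigma> x))"
        by (rule mat_trace_mult_commute[of _ n n]) (use T' R N in auto)
      also have "N * (?T * \<sigma> x) = \<sigma> x"
        using assoc_mult_mat[OF N(2) T' R(2)] N R by simp
      finally show ?thesis .
    qed
    then have "character_of X \<rho> = character_of X \<sigma>"
      unfolding character_of_def by (auto simp: restrict_def)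
    with ne show False by simp
  qed
  then have "?T $$ (i, l) = 0" using ix by simp
  then show ?thesis using ix by (simp add: averaged_mat_def)
qed

text \<open>The averaged matrix is a scalar \<open>c\<close> by \<open>Schur_scalar\<close>. Its
  trace \<open>n * c\<close> collapses, because summing over the outer index multiplies
  \<open>\<rho> (inv x)\<close> with \<open>\<rho> x\<close> and leaves an entry of the identity for
  each \<open>x\<close>.\<close>

lemma matrix_entries_norm:
  assumes X: "group X" "finite (carrier X)" and \<rho>: "irreducible_representation X n \<rho>"
    and ix: "i < n" "j < n" "k < n" "l < n"
  shows "(\<Sum>x\<in>carrier X. \<rho> x $$ (i, j) * \<rho> (inv\<^bsub>X\<^esub> x) $$ (k, l)) =
    (if i = l \<and> j = k then of_nat (Coset.order X) / of_nat n else 0)"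
proof -
  interpret X: group X by fact
  note rep = irreducible_imp_representation[OF \<rho>]
  let ?T = "averaged_mat X n \<rho> n \<rho> j k"
  have T: "?T \<in> carrier_mat n n" by (simp add: averaged_mat_def)
  note TI = averaged_mat_intertwiner[OF X rep rep ix(2,3)]
  have R: "\<rho> x \<in> carrier_mat n n" if "x \<in> carrier X" for x
    using representation_carrier[OF rep X(1) that] .
  obtain c where c: "?T = c \<cdot>\<^sub>m 1\<^sub>m n"
    by (rule Schur_scalar[OF X(1) \<rho> T TI])
  have "of_nat n * c = mat_trace ?T"
    unfolding c by (simp add: mat_trace_def)
  also have "\<dots> = (\<Sum>i<n. \<Sum>x\<in>carrier X. \<rho> x $$ (i, j) * \<rho> (inv\<^bsub>X\<^esub> x) $$ (k, i))"
    by (simp add: mat_trace_def averaged_mat_def)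
  also have "\<dots> = (\<Sum>x\<in>carrier X. \<Sum>i<n. \<rho> (inv\<^bsub>X\<^esub> x) $$ (k, i) * \<rho> x $$ (i, j))"
    by (subst sum.swap) (simp add: mult.commute)
  also have "\<dots> = (\<Sum>x\<in>carrier X. if j = k then 1 else 0)"
  proof (rule sum.cong[OF refl])
    fix x assume x: "x \<in> carrier X"
    then have x': "inv\<^bsub>X\<^esub> x \<in> carrier X" by simp
    have "(\<Sum>i<n. \<rho> (inv\<^bsub>X\<^esub> x) $$ (k, i) * \<rho> x $$ (i, j)) = (\<rho> (inv\<^bsub>X\<^esub> x) * \<rho> x) $$ (k, j)"
      by (rule index_mult_mat_sum[OF R[OF x'] R[OF x] ix(3,2), symmetric])
    also have "\<rho> (inv\<^bsub>X\<^esub> x) * \<rho> x = 1\<^sub>m n"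
      using representation_mult[OF rep X(1) x' x] representation_one[OF rep X(1)] x by simp
    finally show "(\<Sum>i<n. \<rho> (inv\<^bsub>X\<^esub> x) $$ (k, i) * \<rho> x $$ (i, j)) = (if j = k then 1 else 0)"
      using ix by auto
  qed
  also have "\<dots> = (if j = k then of_nat (Coset.order X) else 0)"
    by (simp add: Coset.order_def)
  finally have "c = (if j = k then of_nat (Coset.order X) / of_nat n else 0)"
    using ix(1) by (auto simp: field_simps)
  moreover have "(\<Sum>x\<in>carrier X. \<rho> x $$ (i, j) * \<rho> (inv\<^bsub>X\<^esub> x) $$ (k, l)) = ?T $$ (i, l)"
    using ix by (simp add: averaged_mat_def)
  ultimately show ?thesis
    unfolding c using ix by auto
qed

section \<open>Characters\<close>

lemma character_mult_commute:
  assumes X: "group X" and \<rho>: "is_representation X n \<rho>" and xy: "x \<in> carrier X" "y \<in> carrier X"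
  shows "character_of X \<rho> (x \<otimes>\<^bsub>X\<^esub> y) = character_of X \<rho> (y \<otimes>\<^bsub>X\<^esub> x)"
proof -
  interpret X: group X by fact
  show ?thesis
    using mat_trace_mult_commute[OF representation_carrier[OF \<rho> X xy(1)] representation_carrier[OF \<rho> X xy(2)]] xy
    by (simp add: character_of_def representation_mult[OF \<rho> X])
qed

lemma upper_triangular_mult:
  fixes A B :: "'a :: comm_semiring_1 mat"
  assumes A: "A \<in> carrier_mat n n" "upper_triangular A" and B: "B \<in> carrier_mat n n" "upper_triangular B"
  shows "upper_triangular (A * B)" and "i < n \<Longrightarrow> (A * B) $$ (i, i) = A $$ (i, i) * B $$ (i, i)"
proof -
  have e: "(A * B) $$ (i, j) = (\<Sum>t<n. A $$ (i, t) * B $$ (t, j))" if "i < n" "j < n" for i j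
    using index_mult_mat_sum[OF A(1) B(1) that] .
  have z: "A $$ (i, t) * B $$ (t, j) = 0" if "i < n" "t < n" "t < i \<or> j < t" for i j t
    using that upper_triangularD[OF A(2)] upper_triangularD[OF B(2)] A B by auto
  show "upper_triangular (A * B)"
  proof (rule upper_triangularI)
    fix i j assume "j < i" "i < dim_row (A * B)"
    then have ij: "j < i" "i < n" using A by auto
    have "(\<Sum>t<n. A $$ (i, t) * B $$ (t, j)) = 0"
      by (rule sum.neutral) (use ij in \<open>auto intro!: z\<close>)
    then show "(A * B) $$ (i, j) = 0" using e ij by simp
  qed
  show "(A * B) $$ (i, i) = A $$ (i, i) * B $$ (i, i)" if i: "i < n"
  proof -
    have "(\<Sum>t<n. A $$ (i, t) * B $$ (t, i)) = (\<Sum>t\<in>{i}. A $$ (i, t) * B $$ (t, i))"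
      by (rule sum.mono_neutral_right) (use i in \<open>auto intro!: z\<close>)
    then show ?thesis using e[OF i i] by simp
  qed
qed

lemma upper_triangular_pow:
  fixes A :: "'a :: comm_semiring_1 mat"
  assumes A: "A \<in> carrier_mat n n" "upper_triangular A"
  shows "upper_triangular (A ^\<^sub>m k) \<and> (\<forall>i<n. (A ^\<^sub>m k) $$ (i, i) = A $$ (i, i) ^ k)"
proof (induction k)
  case 0
  show ?case using A by auto
next
  case (Suc k)
  have "A ^\<^sub>m k \<in> carrier_mat n n" using A by simp
  with Suc show ?case
    using upper_triangular_mult[OF _ _ A, of "A ^\<^sub>m k"] by (auto simp: mult.commute)
qed

text \<open>After triangularization the trace of a power is the sum of the powers of the diagonal
  entries. These are roots of unity \<open>b\<close> with \<open>b ^ Suc k = 1\<close>, so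
  \<open>b ^ k\<close> is the inverse of \<open>b\<close>, that is, its conjugate.\<close>

lemma mat_trace_finite_order:
  fixes A :: "complex mat"
  assumes A: "A \<in> carrier_mat n n" and fin: "A ^\<^sub>m Suc k = 1\<^sub>m n"
  shows "mat_trace (A ^\<^sub>m k) = cnj (mat_trace A)"
proof -
  obtain es where es: "char_poly A = (\<Prod>a\<leftarrow>es. [:- a, 1:])"
    using char_poly_factorized[OF A] by blast
  obtain B P Q where "schur_decomposition A es = (B, P, Q)" by (cases "schur_decomposition A es") auto
  from schur_decomposition[OF A es this]
  have wit: "similar_mat_wit A B P Q" and ut: "upper_triangular B" by auto
  have B: "B \<in> carrier_mat n n" using similar_mat_witD2[OF A wit] by simp
  have pw: "mat_trace (A ^\<^sub>m j) = (\<Sum>i<n. (B $$ (i, i)) ^ j)" for j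
  proof -
    have "mat_trace (A ^\<^sub>m j) = mat_trace (B ^\<^sub>m j)"
      by (rule mat_trace_similar[of _ n, OF _ similar_mat_wit_pow[OF wit]]) (use A in simp)
    also have "\<dots> = (\<Sum>i<n. (B $$ (i, i)) ^ j)"
      using upper_triangular_pow[OF B ut, of j] B by (simp add: mat_trace_def)
    finally show ?thesis .
  qed
  have Bk: "B ^\<^sub>m Suc k \<in> carrier_mat n n" by (rule pow_carrier_mat[OF B])
  have "similar_mat_wit (1\<^sub>m n) (B ^\<^sub>m Suc k) P Q"
    using similar_mat_wit_pow[OF wit, of "Suc k"] fin by simp
  from similar_mat_witD2[OF Bk similar_mat_wit_sym[OF this]]
  have "B ^\<^sub>m Suc k = Q * 1\<^sub>m n * P" "Q * P = 1\<^sub>m n" "Q \<in> carrier_mat n n"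
    by auto
  then have "B ^\<^sub>m Suc k = 1\<^sub>m n" by simp
  then have one: "B $$ (i, i) ^ Suc k = 1" if "i < n" for i
    using upper_triangular_pow[OF B ut, of "Suc k"] that by (metis index_one_mat(1))
  have inv: "B $$ (i, i) ^ k = cnj (B $$ (i, i))" if "i < n" for i
  proof -
    let ?b = "B $$ (i, i)"
    have "norm ?b = 1" using power_eq_1_iff[OF one[OF that]] by simp
    then have "?b * cnj ?b = 1" by (simp add: complex_norm_square[symmetric])
    moreover have "?b * ?b ^ k = 1" using one[OF that] by simp
    ultimately show ?thesis by (metis mult_cancel_left mult_zero_left zero_neq_one)
  qed
  show ?thesis
    using pw[of k] pw[of 1] inv A by simp
qed

lemma character_inv:
  assumes X: "group X" "finite (carrier X)" and \<rho>: "is_representation X n \<rho>" and x: "x \<in> carrier X"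
  shows "character_of X \<rho> (inv\<^bsub>X\<^esub> x) = cnj (character_of X \<rho> x)"
proof -
  interpret X: group X by fact
  have R: "\<rho> x \<in> carrier_mat n n" using representation_carrier[OF \<rho> X(1) x] .
  have pw: "\<rho> (x [^]\<^bsub>X\<^esub> j) = \<rho> x ^\<^sub>m j" for j :: nat
    by (induction j) (use R x in \<open>auto simp: representation_one[OF \<rho> X(1)] representation_mult[OF \<rho> X(1)]\<close>)
  \<comment> \<open>With \<open>k\<close> one less than the group order, \<open>inv x\<close> is the
    power of \<open>x\<close> with exponent \<open>k\<close>.\<close>
  obtain k where k: "Coset.order X = Suc k"
    using X.order_gt_0_iff_finite X(2) gr0_conv_Suc by blast
  have one: "x [^]\<^bsub>X\<^esub> Suc k = \<one>\<^bsub>X\<^esub>"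
    using X.pow_order_eq_1[OF x] k by simp
  then have "inv\<^bsub>X\<^esub> x = x [^]\<^bsub>X\<^esub> k"
    using x by (intro X.inv_equality) auto
  moreover have "\<rho> x ^\<^sub>m Suc k = 1\<^sub>m n"
    using pw[of "Suc k"] one by (simp add: representation_one[OF \<rho> X(1)])
  ultimately show ?thesis
    using mat_trace_finite_order[OF R] pw[of k] x by (simp add: character_of_def)
qed

section \<open>Decomposition of characters into irreducible ones\<close>

lemma subspace_adapted_basis:
  assumes W: "VectorSpace.subspace class_ring W (module_vec TYPE(complex) n)"
    and nz: "W \<noteq> {0\<^sub>v n}" "W \<noteq> carrier_vec n"
  obtains P Q k where "0 < k" "k < n" "P \<in> carrier_mat n n" "Q \<in> carrier_mat n n"
    "P * Q = 1\<^sub>m n" "Q * P = 1\<^sub>m n" "\<And>j. j < k \<Longrightarrow> col P j \<in> W"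
    "\<And>w i. w \<in> W \<Longrightarrow> k \<le> i \<Longrightarrow> i < n \<Longrightarrow> (Q *\<^sub>v w) $ i = 0"
proof -
  interpret vec_space "TYPE(complex)" n .
  have sub: "submodule class_ring W V" using W by (simp add: VectorSpace.subspace_def)
  then have Wc: "W \<subseteq> carrier_vec n" and W0: "0\<^sub>v n \<in> W"
    by (auto simp: LinearCombinations.submodule_def module_vec_simps)
  have bound: "finite S \<and> card S \<le> n" if "S \<subseteq> carrier_vec n" "lin_indpt S" for S
    using li_le_dim[OF fin_dim _ that(2)] that(1) by (simp add: dim_is_n)
  \<comment> \<open>A basis is found by maximality twice: \<open>A\<close> is maximal among
    independent subsets of \<open>W\<close>, then \<open>B\<close> among independent sets containing
    \<open>A\<close>. The size bound \<open>n\<close> makes both maxima exist.\<close>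
  have "\<exists>A. finite A \<and> maximal A (\<lambda>S. S \<subseteq> W \<and> lin_indpt S)"
    by (rule maximal_exists[where B = "{}" and N = n]) (use bound Wc in \<open>auto simp: lin_dep_def\<close>)
  then obtain A where finA: "finite A" and mxA: "maximal A (\<lambda>S. S \<subseteq> W \<and> lin_indpt S)"
    by (elim exE conjE)
  from finA mxA have A: "finite A" "A \<subseteq> W" "lin_indpt A" by (auto simp: maximal_def)
  have Amax: "S = A" if "A \<subseteq> S" "S \<subseteq> W" "lin_indpt S" for S
    using mxA that by (simp add: maximal_def)
  have Ac: "A \<subseteq> carrier_vec n" using A Wc by auto
  have WA: "W \<subseteq> span A"
  proof
    fix w assume w: "w \<in> W"
    show "w \<in> span A"
    proof (cases "w \<in> A")
      case True
      then show ?thesis using in_own_span[of A] Ac by auto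
    next
      case False
      show ?thesis
      proof (rule ccontr)
        assume "w \<notin> span A"
        then have "lin_indpt (A \<union> {w})"
          using lin_dep_iff_in_span[of A w] A Ac False w Wc by auto
        then have "A \<union> {w} = A" using w A by (intro Amax) auto
        with False show False by auto
      qed
    qed
  qed
  have "\<exists>B. finite B \<and> maximal B (\<lambda>S. A \<subseteq> S \<and> S \<subseteq> carrier_vec n \<and> lin_indpt S)"
    by (rule maximal_exists[where B = A and N = n]) (use bound A Ac in auto)
  then obtain B where finB: "finite B"
    and mxB: "maximal B (\<lambda>S. A \<subseteq> S \<and> S \<subseteq> carrier_vec n \<and> lin_indpt S)"
    by (elim exE conjE)
  from finB mxB have B: "finite B" "A \<subseteq> B" "B \<subseteq> carrier_vec n" "lin_indpt B"
    by (auto simp: maximal_def)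
  have Bmax: "S = B" if "B \<subseteq> S" "S \<subseteq> carrier_vec n" "lin_indpt S" for S
    using mxB that B(2) by (simp add: maximal_def)
  have "basis B"
    by (rule max_li_is_basis) (use B Bmax in \<open>auto simp: maximal_def\<close>)
  then have cardB: "card B = n" and spanB: "span B = carrier_vec n"
    using dim_basis[OF B(1)] by (auto simp: dim_is_n basis_def)
  obtain xs where xs: "set xs = A" "distinct xs" using A(1) finite_distinct_list by blast
  obtain ys where ys: "set ys = B - A" "distinct ys" using B(1) finite_distinct_list[of "B - A"] by blast
  \<comment> \<open>The columns of \<open>P\<close> are the basis, with its \<open>k\<close> members
    from \<open>W\<close> first; the inverse \<open>Q\<close> reads off coordinates.\<close>
  define P where "P = mat_of_cols n (xs @ ys)"
  define k where "k = length xs"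
  have dzs: "distinct (xs @ ys)" "set (xs @ ys) = B" using xs ys B by auto
  have lzs: "length (xs @ ys) = n" using dzs cardB distinct_card by metis
  have P: "P \<in> carrier_mat n n" using lzs by (simp add: P_def mat_of_cols_def)
  have colsP: "cols P = xs @ ys" unfolding P_def by (rule cols_mat_of_cols) (use dzs B in auto)
  have "det P \<noteq> 0"
    using det_rank_iff[OF P] lin_indpt_full_rank[OF P] dzs B(4) by (simp add: colsP)
  from det_non_zero_imp_unit[OF P this, of "()"] obtain Q where
    Q: "Q \<in> carrier_mat n n" "Q * P = 1\<^sub>m n" "P * Q = 1\<^sub>m n"
    by (auto simp: Units_def ring_mat_simps)
  have colP: "col P j = xs ! j" if "j < k" for j
    using that lzs P cols_nth[of j P] colsP by (simp add: k_def nth_append)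
  have colW: "col P j \<in> W" if "j < k" for j
    using colP[OF that] that xs A by (auto simp: k_def)
  \<comment> \<open>Vanishing of the coordinates from \<open>k\<close> on is a linear condition, so
    it passes from \<open>A\<close> to its span, which contains \<open>W\<close>. On
    \<open>A\<close> it holds because \<open>Q\<close> sends column \<open>j\<close> of
    \<open>P\<close> to a unit vector.\<close>
  define S where "S = {w \<in> carrier_vec n. \<forall>i. k \<le> i \<longrightarrow> i < n \<longrightarrow> (Q *\<^sub>v w) $ i = 0}"
  have "submodule class_ring S V"
    unfolding LinearCombinations.submodule_def S_def using Q
    by (auto simp: module_vec_simps vec_module scalar_prod_add_distrib[of _ n])
  moreover have "A \<subseteq> S"
  proof
    fix a assume a: "a \<in> A"
    then obtain j where j: "j < k" "a = xs ! j" using xs by (auto simp: k_def in_set_conv_nth)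
    have kn: "k \<le> n" using lzs by (auto simp: k_def)
    have "Q *\<^sub>v a = col (Q * P) j"
      unfolding j(2) colP[OF j(1), symmetric]
      by (rule col_mult2[OF Q(1) P, symmetric]) (use j kn in simp)
    then have "Q *\<^sub>v a = unit_vec n j" using Q j kn by simp
    then show "a \<in> S" using a Ac j kn by (auto simp: S_def)
  qed
  ultimately have "span A \<subseteq> S" by (intro span_is_subset)
  with WA have WS: "W \<subseteq> S" by blast
  have "k \<noteq> 0"
  proof
    assume "k = 0"
    have "w = 0\<^sub>v n" if w: "w \<in> W" for w
    proof -
      have wc: "w \<in> carrier_vec n" using w Wc by auto
      have "Q *\<^sub>v w = 0\<^sub>v n"
        using WS w \<open>k = 0\<close> Q(1) by (intro eq_vecI) (auto simp: S_def)
      then have "(P * Q) *\<^sub>v w = 0\<^sub>v n"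
        using assoc_mult_mat_vec[OF P Q(1) wc] P by auto
      then show ?thesis using Q wc by simp
    qed
    with W0 nz show False by blast
  qed
  moreover have "k \<noteq> n"
  proof
    assume "k = n"
    then have "ys = []" using lzs by (simp add: k_def)
    then have "B = A" using ys B by auto
    then have "carrier_vec n \<subseteq> W"
      using span_is_subset[OF A(2) sub] spanB by simp
    with Wc nz show False by auto
  qed
  moreover have "k \<le> n" using lzs by (auto simp: k_def)
  moreover have "(Q *\<^sub>v w) $ i = 0" if "w \<in> W" "k \<le> i" "i < n" for w i
    using WS that by (auto simp: S_def)
  ultimately show thesis using that[of k P Q] P Q colW by auto
qed

lemma sum_lessThan_add_split:
  fixes f :: "nat \<Rightarrow> 'a :: comm_monoid_add"
  shows "(\<Sum>t<k + m. f t) = (\<Sum>t<k. f t) + (\<Sum>t<m. f (k + t))"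
  by (induction m) (auto simp: add.assoc)

text \<open>In a basis adapted to \<open>W\<close> all matrices are block upper triangular. The
  diagonal blocks represent the action on \<open>W\<close> and on the quotient, and the trace sees
  only them.\<close>

lemma representation_reduce:
  assumes X: "group X" and \<rho>: "is_representation X n \<rho>"
    and W: "invariant_subspace X n \<rho> W" "W \<noteq> {0\<^sub>v n}" "W \<noteq> carrier_vec n"
  obtains k m \<alpha> \<delta> where "k < n" "m < n"
    "is_representation X k \<alpha>" "is_representation X m \<delta>"
    "\<And>x. x \<in> carrier X \<Longrightarrow> mat_trace (\<rho> x) = mat_trace (\<alpha> x) + mat_trace (\<delta> x)"
proof -
  interpret X: group X by fact
  have "VectorSpace.subspace class_ring W (module_vec TYPE(complex) n)"
    and inv: "\<And>x w. x \<in> carrier X \<Longrightarrow> w \<in> W \<Longrightarrow> \<rho> x *\<^sub>v w \<in> W"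
    using W(1) by (auto simp: invariant_subspace_def)
  from subspace_adapted_basis[OF this(1) W(2,3)]
  obtain P Q k where k: "0 < k" "k < n" and P: "P \<in> carrier_mat n n" and Q: "Q \<in> carrier_mat n n"
    and PQ: "P * Q = 1\<^sub>m n" "Q * P = 1\<^sub>m n" and colP: "\<And>j. j < k \<Longrightarrow> col P j \<in> W"
    and QW: "\<And>w i. w \<in> W \<Longrightarrow> k \<le> i \<Longrightarrow> i < n \<Longrightarrow> (Q *\<^sub>v w) $ i = 0"
    by metis
  define m where "m = n - k"
  have n: "n = k + m" and m: "m < n" using k by (auto simp: m_def)
  define \<tau> where "\<tau> x = Q * \<rho> x * P" for x
  define \<alpha> where "\<alpha> x = mat k k (\<lambda>(i, j). \<tau> x $$ (i, j))" for x
  define \<delta> where "\<delta> x = mat m m (\<lambda>(i, j). \<tau> x $$ (k + i, k + j))" for x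
  have R: "\<rho> x \<in> carrier_mat n n" if "x \<in> carrier X" for x
    using representation_carrier[OF \<rho> X that] .
  have T: "\<tau> x \<in> carrier_mat n n" if "x \<in> carrier X" for x
    using P Q R[OF that] by (simp add: \<tau>_def)
  have T1: "\<tau> \<one>\<^bsub>X\<^esub> = 1\<^sub>m n"
    using P Q PQ by (simp add: \<tau>_def representation_one[OF \<rho> X])
  have Tm: "\<tau> (x \<otimes>\<^bsub>X\<^esub> y) = \<tau> x * \<tau> y" if xy: "x \<in> carrier X" "y \<in> carrier X" for x y
  proof -
    have c: "\<rho> x \<in> carrier_mat n n" "\<rho> y \<in> carrier_mat n n" using R xy by auto
    have "\<tau> x * \<tau> y = (Q * \<rho> x) * (P * (Q * \<rho> y * P))"
      unfolding \<tau>_def by (rule assoc_mult_mat) (use P Q c in auto)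
    also have "P * (Q * \<rho> y * P) = P * (Q * (\<rho> y * P))"
      using assoc_mult_mat[OF Q c(2) P] by simp
    also have "\<dots> = (P * Q) * (\<rho> y * P)"
      by (rule assoc_mult_mat[symmetric]) (use P Q c in auto)
    also have "\<dots> = \<rho> y * P" using PQ P c by simp
    also have "(Q * \<rho> x) * (\<rho> y * P) = (Q * \<rho> x * \<rho> y) * P"
      by (rule assoc_mult_mat[symmetric]) (use P Q c in auto)
    also have "Q * \<rho> x * \<rho> y = Q * (\<rho> x * \<rho> y)"
      by (rule assoc_mult_mat) (use P Q c in auto)
    finally show ?thesis
      unfolding \<tau>_def by (simp add: representation_mult[OF \<rho> X xy])
  qed
  \<comment> \<open>Lower left block: \<open>\<rho> x\<close> keeps the first \<open>k\<close> basis
    vectors inside \<open>W\<close>, where the later coordinates vanish.\<close>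
  have low: "\<tau> x $$ (i, j) = 0" if x: "x \<in> carrier X" and ij: "j < k" "k \<le> i" "i < n" for x i j
  proof -
    have "\<tau> x $$ (i, j) = (Q * (\<rho> x * P)) $$ (i, j)"
      using assoc_mult_mat[OF Q R[OF x] P] by (simp add: \<tau>_def)
    also have "\<dots> = (Q *\<^sub>v col (\<rho> x * P) j) $ i"
    proof -
      have "(Q * B) $$ (i, j) = (Q *\<^sub>v col B j) $ i" if "B \<in> carrier_mat n n" for B
        using Q that ij k by simp
      then show ?thesis using mult_carrier_mat[OF R[OF x] P] by simp
    qed
    also have "col (\<rho> x * P) j = \<rho> x *\<^sub>v col P j"
      by (rule col_mult2[OF R[OF x] P]) (use ij in simp)
    also have "(Q *\<^sub>v (\<rho> x *\<^sub>v col P j)) $ i = 0" by (rule QW[OF inv[OF x colP[OF ij(1)]] ij(2,3)])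
    finally show ?thesis .
  qed
  \<comment> \<open>The sum is cut at \<open>k\<close>, since for each diagonal block one of the two
    halves dies by \<open>low\<close>.\<close>
  have mult: "\<tau> (x \<otimes>\<^bsub>X\<^esub> y) $$ (i, j) =
      (\<Sum>t<k. \<tau> x $$ (i, t) * \<tau> y $$ (t, j)) + (\<Sum>t<m. \<tau> x $$ (i, k + t) * \<tau> y $$ (k + t, j))"
    if "x \<in> carrier X" "y \<in> carrier X" "i < n" "j < n" for x y i j
    using Tm[OF that(1,2)] index_mult_mat_sum[OF T[OF that(1)] T[OF that(2)] that(3,4)]
    by (simp add: n sum_lessThan_add_split)
  have "is_representation X k \<alpha>"
    unfolding is_representation_iff[OF X]
  proof (intro conjI ballI)
    show "\<alpha> \<one>\<^bsub>X\<^esub> = 1\<^sub>m k" by (rule eq_matI) (use k in \<open>auto simp: \<alpha>_def T1\<close>)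
    fix x y assume xy: "x \<in> carrier X" "y \<in> carrier X"
    show "\<alpha> (x \<otimes>\<^bsub>X\<^esub> y) = \<alpha> x * \<alpha> y"
    proof (rule eq_matI)
      fix i j assume "i < dim_row (\<alpha> x * \<alpha> y)" "j < dim_col (\<alpha> x * \<alpha> y)"
      then have ij: "i < k" "j < k" by (auto simp: \<alpha>_def)
      have "(\<Sum>t<m. \<tau> x $$ (i, k + t) * \<tau> y $$ (k + t, j)) = 0"
        by (rule sum.neutral) (use low[OF xy(2) ij(2)] n in auto)
      moreover have "(\<alpha> x * \<alpha> y) $$ (i, j) = (\<Sum>t<k. \<alpha> x $$ (i, t) * \<alpha> y $$ (t, j))"
        by (rule index_mult_mat_sum[OF _ _ ij, of _ k]) (auto simp: \<alpha>_def)
      ultimately show "\<alpha> (x \<otimes>\<^bsub>X\<^esub> y) $$ (i, j) = (\<alpha> x * \<alpha> y) $$ (i, j)"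
        using mult[OF xy, of i j] ij k by (simp add: \<alpha>_def)
    qed (auto simp: \<alpha>_def)
  qed (auto simp: \<alpha>_def)
  moreover have "is_representation X m \<delta>"
    unfolding is_representation_iff[OF X]
  proof (intro conjI ballI)
    show "\<delta> \<one>\<^bsub>X\<^esub> = 1\<^sub>m m" by (rule eq_matI) (use n in \<open>auto simp: \<delta>_def T1\<close>)
    fix x y assume xy: "x \<in> carrier X" "y \<in> carrier X"
    show "\<delta> (x \<otimes>\<^bsub>X\<^esub> y) = \<delta> x * \<delta> y"
    proof (rule eq_matI)
      fix i j assume "i < dim_row (\<delta> x * \<delta> y)" "j < dim_col (\<delta> x * \<delta> y)"
      then have ij: "i < m" "j < m" by (auto simp: \<delta>_def)
      have "(\<Sum>t<k. \<tau> x $$ (k + i, t) * \<tau> y $$ (t, k + j)) = 0"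
        by (rule sum.neutral) (use low[OF xy(1)] ij n in auto)
      moreover have "(\<delta> x * \<delta> y) $$ (i, j) = (\<Sum>t<m. \<delta> x $$ (i, t) * \<delta> y $$ (t, j))"
        by (rule index_mult_mat_sum[OF _ _ ij, of _ m]) (auto simp: \<delta>_def)
      ultimately show "\<delta> (x \<otimes>\<^bsub>X\<^esub> y) $$ (i, j) = (\<delta> x * \<delta> y) $$ (i, j)"
        using mult[OF xy, of "k + i" "k + j"] ij n by (simp add: \<delta>_def)
    qed (auto simp: \<delta>_def)
  qed (auto simp: \<delta>_def)
  moreover have "mat_trace (\<rho> x) = mat_trace (\<alpha> x) + mat_trace (\<delta> x)" if x: "x \<in> carrier X" for x
  proof -
    have c: "\<rho> x \<in> carrier_mat n n" using R x .
    have "mat_trace (\<tau> x) = mat_trace (P * (Q * \<rho> x))"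
      unfolding \<tau>_def by (rule mat_trace_mult_commute[of _ n n]) (use P Q c in auto)
    also have "P * (Q * \<rho> x) = (P * Q) * \<rho> x"
      by (rule assoc_mult_mat[OF P Q c, symmetric])
    also have "\<dots> = \<rho> x" using PQ c by simp
    finally have "mat_trace (\<rho> x) = mat_trace (\<tau> x)" by simp
    also have "\<dots> = (\<Sum>i<k + m. \<tau> x $$ (i, i))"
      using T[OF x] n by (simp add: mat_trace_def)
    finally show ?thesis
      by (simp add: sum_lessThan_add_split mat_trace_def \<alpha>_def \<delta>_def)
  qed
  ultimately show thesis using that k(2) m by blast
qed

text \<open>Induction on the degree, splitting along an invariant subspace. \<open>L\<close> is a
  list so that repeated constituents keep their multiplicity.\<close>

lemma character_sum_irreducible:
  assumes X: "group X" and \<rho>: "is_representation X n \<rho>"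
  obtains L where "set L \<subseteq> Irr X" "\<And>x. x \<in> carrier X \<Longrightarrow> mat_trace (\<rho> x) = (\<Sum>\<chi>\<leftarrow>L. \<chi> x)"
proof -
  have "\<exists>L. set L \<subseteq> Irr X \<and> (\<forall>x\<in>carrier X. mat_trace (\<rho> x) = (\<Sum>\<chi>\<leftarrow>L. \<chi> x))"
    using \<rho>
  proof (induction n arbitrary: \<rho> rule: less_induct)
    case (less n)
    consider "n = 0" | "n > 0" "irreducible_representation X n \<rho>"
      | W where "invariant_subspace X n \<rho> W" "W \<noteq> {0\<^sub>v n}" "W \<noteq> carrier_vec n"
      using less.prems by (auto simp: irreducible_representation_def)
    then show ?case
    proof cases
      case 1
      then have "mat_trace (\<rho> x) = 0" if "x \<in> carrier X" for x
        using representation_carrier[OF less.prems X that] by (auto simp: mat_trace_def)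
      then show ?thesis by (intro exI[of _ "[]"]) auto
    next
      case 2
      then show ?thesis
        by (intro exI[of _ "[character_of X \<rho>]"]) (auto simp: Irr_def character_of_def)
    next
      case 3
      from representation_reduce[OF X less.prems 3]
      obtain k m \<alpha> \<delta> where r: "k < n" "m < n" "is_representation X k \<alpha>" "is_representation X m \<delta>"
        "\<And>x. x \<in> carrier X \<Longrightarrow> mat_trace (\<rho> x) = mat_trace (\<alpha> x) + mat_trace (\<delta> x)"
        by metis
      obtain L L' where
        "set L \<subseteq> Irr X \<and> (\<forall>x\<in>carrier X. mat_trace (\<alpha> x) = (\<Sum>\<chi>\<leftarrow>L. \<chi> x))"
        "set L' \<subseteq> Irr X \<and> (\<forall>x\<in>carrier X. mat_trace (\<delta> x) = (\<Sum>\<chi>\<leftarrow>L'. \<chi> x))"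
        using less.IH[OF r(1,3)] less.IH[OF r(2,4)] by blast
      then show ?thesis
        by (intro exI[of _ "L @ L'"]) (auto simp: r(5))
    qed
  qed
  then show thesis using that by blast
qed

lemma IrrE:
  assumes "\<chi> \<in> Irr X"
  obtains n \<rho> where "irreducible_representation X n \<rho>" "is_representation X n \<rho>"
    "\<chi> = character_of X \<rho>"
  using assms that irreducible_imp_representation unfolding Irr_def by blast

lemma Irr_mult_commute:
  assumes "\<chi> \<in> Irr X" "group X" "x \<in> carrier X" "y \<in> carrier X"
  shows "\<chi> (x \<otimes>\<^bsub>X\<^esub> y) = \<chi> (y \<otimes>\<^bsub>X\<^esub> x)"
  using assms(1) by (rule IrrE) (simp add: character_mult_commute[OF assms(2) _ assms(3,4)])

lemma Irr_inv:
  assumes "\<chi> \<in> Irr X" "group X" "finite (carrier X)" "x \<in> carrier X"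
  shows "\<chi> (inv\<^bsub>X\<^esub> x) = cnj (\<chi> x)"
  using assms(1) by (rule IrrE) (simp add: character_inv[OF assms(2,3) _ assms(4)])

lemma Irr_one_nonzero:
  assumes \<chi>: "\<chi> \<in> Irr X" and X: "group X"
  shows "\<chi> \<one>\<^bsub>X\<^esub> \<noteq> 0"
proof -
  obtain n \<rho> where r: "irreducible_representation X n \<rho>" "is_representation X n \<rho>"
    "\<chi> = character_of X \<rho>" using \<chi> by (rule IrrE)
  interpret X: group X by fact
  show ?thesis
    using r(1) by (simp add: r(3) character_of_def representation_one[OF r(2) X] mat_trace_one
        irreducible_representation_def)
qed

section \<open>Convolution\<close>

definition conv :: "('a, 'b) monoid_scheme \<Rightarrow> ('a \<Rightarrow> complex) \<Rightarrow> ('a \<Rightarrow> complex) \<Rightarrow> 'a \<Rightarrow> complex" where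
  "conv X f h g = (\<Sum>x\<in>carrier X. f x * h (inv\<^bsub>X\<^esub> x \<otimes>\<^bsub>X\<^esub> g))"

text \<open>Identities between characters hold on the carrier only, so rewriting inside a
  convolution cannot use equality of functions and goes through this rule.\<close>

lemma conv_cong:
  assumes "group X" "\<And>x. x \<in> carrier X \<Longrightarrow> f x = f' x" "\<And>x. x \<in> carrier X \<Longrightarrow> h x = h' x" "g \<in> carrier X"
  shows "conv X f h g = conv X f' h' g"
proof -
  interpret group X by fact
  show ?thesis unfolding conv_def using assms(2-) by (intro sum.cong) auto
qed

lemma conv_sum_left:
  "conv X (\<lambda>x. \<Sum>i\<in>S. c i * f i x) h g = (\<Sum>i\<in>S. c i * conv X (f i) h g)"
  unfolding conv_def
  by (simp add: sum_distrib_right sum_distrib_left mult.assoc sum.swap[of _ S])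

lemma conv_sum_right:
  "conv X f (\<lambda>x. \<Sum>i\<in>S. c i * h i x) g = (\<Sum>i\<in>S. c i * conv X f (h i) g)"
  unfolding conv_def
  by (simp add: sum_distrib_right sum_distrib_left mult.left_commute sum.swap[of _ S])

lemma conv_add_left: "conv X (\<lambda>x. f x + f' x) h g = conv X f h g + conv X f' h g"
  by (simp add: conv_def distrib_right sum.distrib)

lemma conv_add_right: "conv X f (\<lambda>x. h x + h' x) g = conv X f h g + conv X f h' g"
  by (simp add: conv_def distrib_left sum.distrib)

lemma conv_scale_left: "conv X (\<lambda>x. c * f x) h g = c * conv X f h g"
  by (simp add: conv_def sum_distrib_left mult.assoc)

lemma conv_scale_right: "conv X f (\<lambda>x. c * h x) g = c * conv X f h g"
  by (simp add: conv_def sum_distrib_left mult.left_commute)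

lemma conv_assoc:
  assumes X: "group X" "finite (carrier X)" and g: "g \<in> carrier X"
  shows "conv X (conv X f h) k g = conv X f (conv X h k) g"
proof -
  interpret group X by fact
  have "conv X (conv X f h) k g =
      (\<Sum>x\<in>carrier X. \<Sum>y\<in>carrier X. f y * (h (inv\<^bsub>X\<^esub> y \<otimes>\<^bsub>X\<^esub> x) * k (inv\<^bsub>X\<^esub> x \<otimes>\<^bsub>X\<^esub> g)))"
    by (simp add: conv_def sum_distrib_right mult.assoc)
  also have "\<dots> = (\<Sum>y\<in>carrier X. f y * (\<Sum>x\<in>carrier X. h (inv\<^bsub>X\<^esub> y \<otimes>\<^bsub>X\<^esub> x) * k (inv\<^bsub>X\<^esub> x \<otimes>\<^bsub>X\<^esub> g)))"
    by (subst sum.swap) (simp add: sum_distrib_left)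
  also have "\<dots> = (\<Sum>y\<in>carrier X. f y * (\<Sum>z\<in>carrier X. h z * k (inv\<^bsub>X\<^esub> z \<otimes>\<^bsub>X\<^esub> (inv\<^bsub>X\<^esub> y \<otimes>\<^bsub>X\<^esub> g))))"
  proof (rule sum.cong[OF refl], rule arg_cong[where f = "\<lambda>z. f _ * z"])
    fix y assume y: "y \<in> carrier X"
    show "(\<Sum>x\<in>carrier X. h (inv\<^bsub>X\<^esub> y \<otimes>\<^bsub>X\<^esub> x) * k (inv\<^bsub>X\<^esub> x \<otimes>\<^bsub>X\<^esub> g))
      = (\<Sum>z\<in>carrier X. h z * k (inv\<^bsub>X\<^esub> z \<otimes>\<^bsub>X\<^esub> (inv\<^bsub>X\<^esub> y \<otimes>\<^bsub>X\<^esub> g)))"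
      by (rule sum.reindex_bij_witness[of _ "\<lambda>z. y \<otimes>\<^bsub>X\<^esub> z" "\<lambda>x. inv\<^bsub>X\<^esub> y \<otimes>\<^bsub>X\<^esub> x"])
        (use y g in \<open>auto simp: inv_mult_group m_assoc inv_solve_left m_assoc[symmetric]\<close>)
  qed
  also have "\<dots> = conv X f (conv X h k) g" by (simp add: conv_def)
  finally show ?thesis .
qed

lemma conv_one_right:
  assumes "group X" "finite (carrier X)" "g \<in> carrier X"
  shows "conv X f (\<lambda>x. if x = \<one>\<^bsub>X\<^esub> then 1 else 0) g = f g"
proof -
  interpret group X by fact
  have "(inv\<^bsub>X\<^esub> x \<otimes>\<^bsub>X\<^esub> g = \<one>\<^bsub>X\<^esub>) = (x = g)" if "x \<in> carrier X" for x
    using that assms(3) by (metis inv_closed inv_equality inv_inv l_inv)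
  then have "conv X f (\<lambda>x. if x = \<one>\<^bsub>X\<^esub> then 1 else 0) g = (\<Sum>x\<in>carrier X. if x = g then f x else 0)"
    unfolding conv_def by (intro sum.cong) auto
  then show ?thesis using assms by simp
qed

lemma conv_one_left:
  assumes "group X" "finite (carrier X)" "g \<in> carrier X"
  shows "conv X (\<lambda>x. if x = \<one>\<^bsub>X\<^esub> then 1 else 0) h g = h g"
proof -
  interpret group X by fact
  have "conv X (\<lambda>x. if x = \<one>\<^bsub>X\<^esub> then 1 else 0) h g =
      (\<Sum>x\<in>carrier X. if x = \<one>\<^bsub>X\<^esub> then h g else 0)"
    unfolding conv_def using assms by (intro sum.cong) auto
  then show ?thesis using assms by simp
qed

text \<open>Class functions are central in the group algebra: substitute \<open>y\<close> for the
  argument of \<open>h\<close>, then swap the two factors inside \<open>f\<close>.\<close>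

lemma conv_class_commute:
  assumes X: "group X" and g: "g \<in> carrier X"
    and cl: "\<And>x y. x \<in> carrier X \<Longrightarrow> y \<in> carrier X \<Longrightarrow> f (x \<otimes>\<^bsub>X\<^esub> y) = f (y \<otimes>\<^bsub>X\<^esub> x)"
  shows "conv X f h g = conv X h f g"
proof -
  interpret group X by fact
  have "conv X f h g = (\<Sum>y\<in>carrier X. f (g \<otimes>\<^bsub>X\<^esub> inv\<^bsub>X\<^esub> y) * h y)"
    unfolding conv_def
    by (rule sum.reindex_bij_witness[of _ "\<lambda>y. g \<otimes>\<^bsub>X\<^esub> inv\<^bsub>X\<^esub> y" "\<lambda>x. inv\<^bsub>X\<^esub> x \<otimes>\<^bsub>X\<^esub> g"])
      (use g in \<open>auto simp: inv_mult_group m_assoc[symmetric] inv_solve_left\<close>, auto simp: m_assoc)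
  also have "\<dots> = conv X h f g"
    unfolding conv_def using g cl by (intro sum.cong refl) (simp add: mult.commute)
  finally show ?thesis .
qed

text \<open>Writing both characters as traces leaves, for fixed matrix indices, a sum over the group
  that the Schur relations evaluate. The outcome is that the functions
  \<open>\<chi> \<one> / |X| * \<chi>\<close> are pairwise orthogonal idempotents.\<close>

lemma conv_Irr:
  assumes X: "group X" "finite (carrier X)" and \<chi>: "\<chi> \<in> Irr X" and \<psi>: "\<psi> \<in> Irr X"
    and g: "g \<in> carrier X"
  shows "conv X \<chi> \<psi> g = (if \<chi> = \<psi> then of_nat (Coset.order X) / \<chi> \<one>\<^bsub>X\<^esub> * \<chi> g else 0)"
proof -
  interpret X: group X by fact
  obtain n \<rho> where r: "irreducible_representation X n \<rho>" "is_representation X n \<rho>"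
    "\<chi> = character_of X \<rho>" using \<chi> by (rule IrrE)
  obtain m \<sigma>0 where s0: "irreducible_representation X m \<sigma>0" "is_representation X m \<sigma>0"
    "\<psi> = character_of X \<sigma>0" using \<psi> by (rule IrrE)
  \<comment> \<open>Equal characters may come with different matrices, while
    \<open>matrix_entries_norm\<close> speaks of a single representation. So the same one is chosen
    for both when \<open>\<chi> = \<psi>\<close>.\<close>
  have *: "\<exists>m \<sigma>. irreducible_representation X m \<sigma> \<and> is_representation X m \<sigma> \<and> \<psi> = character_of X \<sigma>
    \<and> (\<chi> = \<psi> \<longrightarrow> m = n \<and> \<sigma> = \<rho>)"
    using r s0 by (cases "\<chi> = \<psi>") auto
  then obtain m \<sigma> where s: "irreducible_representation X m \<sigma>" "is_representation X m \<sigma>"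
    "\<psi> = character_of X \<sigma>" and same: "\<chi> = \<psi> \<Longrightarrow> m = n \<and> \<sigma> = \<rho>" by blast
  have R: "\<rho> x \<in> carrier_mat n n" "\<sigma> x \<in> carrier_mat m m" if "x \<in> carrier X" for x
    using representation_carrier[OF r(2) X(1) that] representation_carrier[OF s(2) X(1) that] .
  have "conv X \<chi> \<psi> g = (\<Sum>x\<in>carrier X. (\<Sum>i<n. \<rho> x $$ (i, i)) *
      (\<Sum>k<m. \<Sum>l<m. \<sigma> (inv\<^bsub>X\<^esub> x) $$ (k, l) * \<sigma> g $$ (l, k)))"
    unfolding conv_def
  proof (rule sum.cong[OF refl])
    fix x assume x: "x \<in> carrier X"
    then have x': "inv\<^bsub>X\<^esub> x \<in> carrier X" by simp
    have "\<psi> (inv\<^bsub>X\<^esub> x \<otimes>\<^bsub>X\<^esub> g) = mat_trace (\<sigma> (inv\<^bsub>X\<^esub> x) * \<sigma> g)"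
      using x' g by (simp add: s(3) character_of_def representation_mult[OF s(2) X(1)])
    also have "\<dots> = (\<Sum>k<m. (\<sigma> (inv\<^bsub>X\<^esub> x) * \<sigma> g) $$ (k, k))"
      using R(2)[OF x'] by (simp add: mat_trace_def)
    also have "\<dots> = (\<Sum>k<m. \<Sum>l<m. \<sigma> (inv\<^bsub>X\<^esub> x) $$ (k, l) * \<sigma> g $$ (l, k))"
      by (rule sum.cong[OF refl]) (rule index_mult_mat_sum[OF R(2)[OF x'] R(2)[OF g]]; simp)
    finally show "\<chi> x * \<psi> (inv\<^bsub>X\<^esub> x \<otimes>\<^bsub>X\<^esub> g) = (\<Sum>i<n. \<rho> x $$ (i, i)) *
      (\<Sum>k<m. \<Sum>l<m. \<sigma> (inv\<^bsub>X\<^esub> x) $$ (k, l) * \<sigma> g $$ (l, k))"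
      using x R(1)[OF x] by (simp add: r(3) character_of_def mat_trace_def)
  qed
  also have "\<dots> = (\<Sum>x\<in>carrier X. \<Sum>i<n. \<Sum>k<m. \<Sum>l<m.
      \<rho> x $$ (i, i) * \<sigma> (inv\<^bsub>X\<^esub> x) $$ (k, l) * \<sigma> g $$ (l, k))"
    by (simp only: sum_distrib_right) (simp only: sum_distrib_left mult.assoc)
  also have "\<dots> = (\<Sum>i<n. \<Sum>k<m. \<Sum>l<m.
      (\<Sum>x\<in>carrier X. \<rho> x $$ (i, i) * \<sigma> (inv\<^bsub>X\<^esub> x) $$ (k, l)) * \<sigma> g $$ (l, k))"
    by (simp only: sum.swap[of _ _ "carrier X"] sum_distrib_right)
  also have "\<dots> = (if \<chi> = \<psi> then of_nat (Coset.order X) / \<chi> \<one>\<^bsub>X\<^esub> * \<chi> g else 0)"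
  proof (cases "\<chi> = \<psi>")
    case False
    then have "(\<Sum>x\<in>carrier X. \<rho> x $$ (i, i) * \<sigma> (inv\<^bsub>X\<^esub> x) $$ (k, l)) = 0"
      if "i < n" "k < m" "l < m" for i k l
      using matrix_entries_orthogonal[OF X r(1) s(1)] that r(3) s(3) by auto
    then show ?thesis using False by simp
  next
    case True
    then have ms: "m = n" "\<sigma> = \<rho>" using same by auto
    have "(\<Sum>i<n. \<Sum>k<n. \<Sum>l<n.
      (\<Sum>x\<in>carrier X. \<rho> x $$ (i, i) * \<rho> (inv\<^bsub>X\<^esub> x) $$ (k, l)) * \<rho> g $$ (l, k)) =
      (\<Sum>i<n. \<Sum>k<n. \<Sum>l<n. if l = i then if k = i then of_nat (Coset.order X) / of_nat n * \<rho> g $$ (i, i) else 0 else 0)"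
      by (intro sum.cong refl) (auto simp: matrix_entries_norm[OF X r(1)])
    also have "\<dots> = (\<Sum>i<n. of_nat (Coset.order X) / of_nat n * \<rho> g $$ (i, i))"
      by (intro sum.cong refl) simp
    also have "\<dots> = of_nat (Coset.order X) / of_nat n * \<chi> g"
      using g R(1)[OF g] by (simp add: r(3) character_of_def mat_trace_def sum_distrib_left)
    also have "of_nat n = \<chi> \<one>\<^bsub>X\<^esub>"
      by (simp add: r(3) character_of_def representation_one[OF r(2) X(1)] mat_trace_one)
    finally show ?thesis using True ms by simp
  qed
  finally show ?thesis .
qed

section \<open>The regular character\<close>

lemma regular_character_list:
  assumes X: "group X" "finite (carrier X)"
  obtains L where "set L \<subseteq> Irr X"
    "\<And>x. x \<in> carrier X \<Longrightarrow> (\<Sum>\<chi>\<leftarrow>L. \<chi> x) = (if x = \<one>\<^bsub>X\<^esub> then of_nat (Coset.order X) else 0)"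
proof -
  interpret X: group X by fact
  define N where "N = card (carrier X)"
  obtain f where f: "bij_betw f {..<N} (carrier X)"
    using ex_bij_betw_nat_finite[OF X(2)] by (auto simp: N_def atLeast0LessThan)
  have fc: "f i \<in> carrier X" if "i < N" for i using f that by (auto simp: bij_betw_def)
  have finj: "f i = f j \<longleftrightarrow> i = j" if "i < N" "j < N" for i j
    using f that by (auto simp: bij_betw_def inj_on_def)
  \<comment> \<open>Permutation matrices of left multiplication on the enumerated group. The trace
    counts fixed points, and only the identity has any.\<close>
  define \<rho> where "\<rho> x = (mat N N (\<lambda>(i, j). if f i = x \<otimes>\<^bsub>X\<^esub> f j then 1 else 0) :: complex mat)" for x
  have "is_representation X N \<rho>"
    unfolding is_representation_iff[OF X(1)]
  proof (intro conjI ballI)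
    show "\<rho> \<one>\<^bsub>X\<^esub> = 1\<^sub>m N" by (rule eq_matI) (auto simp: \<rho>_def fc finj)
    fix x y assume xy: "x \<in> carrier X" "y \<in> carrier X"
    show "\<rho> (x \<otimes>\<^bsub>X\<^esub> y) = \<rho> x * \<rho> y"
    proof (rule eq_matI)
      fix i j assume "i < dim_row (\<rho> x * \<rho> y)" "j < dim_col (\<rho> x * \<rho> y)"
      then have ij: "i < N" "j < N" by (auto simp: \<rho>_def)
      have "y \<otimes>\<^bsub>X\<^esub> f j \<in> f ` {..<N}" using f xy fc[OF ij(2)] by (auto simp: bij_betw_def)
      then obtain t where t: "t < N" "f t = y \<otimes>\<^bsub>X\<^esub> f j" by auto
      have "(\<rho> x * \<rho> y) $$ (i, j) = (\<Sum>a<N. \<rho> x $$ (i, a) * \<rho> y $$ (a, j))"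
        by (rule index_mult_mat_sum[OF _ _ ij]) (auto simp: \<rho>_def)
      also have "\<dots> = (\<Sum>a<N. if a = t then \<rho> x $$ (i, a) else 0)"
        by (intro sum.cong refl) (use ij t finj in \<open>auto simp: \<rho>_def t(2)[symmetric]\<close>)
      also have "\<dots> = \<rho> x $$ (i, t)" using t by simp
      also have "\<dots> = \<rho> (x \<otimes>\<^bsub>X\<^esub> y) $$ (i, j)"
        using ij t xy fc by (simp add: \<rho>_def X.m_assoc)
      finally show "\<rho> (x \<otimes>\<^bsub>X\<^esub> y) $$ (i, j) = (\<rho> x * \<rho> y) $$ (i, j)" ..
    qed (auto simp: \<rho>_def)
  qed (auto simp: \<rho>_def)
  then obtain L where L: "set L \<subseteq> Irr X" "\<And>x. x \<in> carrier X \<Longrightarrow> mat_trace (\<rho> x) = (\<Sum>\<chi>\<leftarrow>L. \<chi> x)"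
    by (rule character_sum_irreducible[OF X(1)]) blast
  have "mat_trace (\<rho> x) = (if x = \<one>\<^bsub>X\<^esub> then of_nat (Coset.order X) else 0)" if x: "x \<in> carrier X" for x
  proof -
    have "mat_trace (\<rho> x) = (\<Sum>i<N. if f i = x \<otimes>\<^bsub>X\<^esub> f i then 1 else 0)"
      by (simp add: mat_trace_def \<rho>_def)
    also have "\<dots> = (\<Sum>i<N. if x = \<one>\<^bsub>X\<^esub> then 1 else 0)"
      by (intro sum.cong refl) (use x fc in \<open>auto simp: X.r_cancel_one'\<close>)
    finally show ?thesis by (simp add: N_def Coset.order_def)
  qed
  then show thesis using that L by auto
qed

lemma sum_list_map_eq_sum_count_semiring:
  "(\<Sum>x\<leftarrow>xs. f x :: 'b :: semiring_1) = (\<Sum>x\<in>set xs. of_nat (count_list xs x) * f x)"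
proof (induction xs)
  case (Cons a xs)
  show ?case
  proof (cases "a \<in> set xs")
    case True
    have "(\<Sum>x\<in>set xs. of_nat (count_list (a # xs) x) * f x)
      = (\<Sum>x\<in>set xs. of_nat (count_list xs x) * f x + (if x = a then f x else 0))"
      by (intro sum.cong) (auto simp: distrib_right add.commute)
    also have "\<dots> = (\<Sum>x\<in>set xs. of_nat (count_list xs x) * f x) + f a"
      using True by (simp add: sum.distrib)
    finally show ?thesis using Cons True by (simp add: insert_absorb add.commute)
  next
    case False
    then have "(\<Sum>x\<in>set xs. of_nat (count_list (a # xs) x) * f x) = (\<Sum>x\<in>set xs. of_nat (count_list xs x) * f x)"
      by (intro sum.cong) auto
    then show ?thesis using Cons False by (simp add: count_notin)
  qed
qed simp

text \<open>Convolving the regular character, a multiple of the unit, with an irreducible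
  \<open>\<psi>\<close> isolates the term of \<open>\<psi>\<close> by \<open>conv_Irr\<close>. So
  \<open>\<psi>\<close> occurs in \<open>L\<close>, with multiplicity \<open>\<psi> \<one>\<close>;
  in particular the finite list exhausts \<open>Irr X\<close>.\<close>

lemma
  assumes X: "group X" "finite (carrier X)"
  shows finite_Irr: "finite (Irr X)"
    and regular_character: "\<And>x. x \<in> carrier X \<Longrightarrow>
      (\<Sum>\<chi>\<in>Irr X. \<chi> \<one>\<^bsub>X\<^esub> * \<chi> x) = (if x = \<one>\<^bsub>X\<^esub> then of_nat (Coset.order X) else 0)"
proof -
  interpret X: group X by fact
  have N: "of_nat (Coset.order X) \<noteq> (0 :: complex)"
    using X.order_gt_0_iff_finite X(2) by simp
  obtain L where L: "set L \<subseteq> Irr X"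
    "\<And>x. x \<in> carrier X \<Longrightarrow> (\<Sum>\<chi>\<leftarrow>L. \<chi> x) = (if x = \<one>\<^bsub>X\<^esub> then of_nat (Coset.order X) else 0)"
    by (rule regular_character_list[OF X]) blast
  define c :: "_ \<Rightarrow> complex" where "c \<chi> = of_nat (count_list L \<chi>)" for \<chi>
  have reg: "(\<Sum>\<chi>\<in>set L. c \<chi> * \<chi> x) = of_nat (Coset.order X) * (if x = \<one>\<^bsub>X\<^esub> then 1 else 0)"
    if "x \<in> carrier X" for x
    using L(2)[OF that] by (simp add: c_def sum_list_map_eq_sum_count_semiring[where f = "\<lambda>\<chi>. \<chi> x"])
  have *: "\<psi> \<in> set L \<and> c \<psi> = \<psi> \<one>\<^bsub>X\<^esub>" if \<psi>: "\<psi> \<in> Irr X" for \<psi>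
  proof -
    have "(\<Sum>\<chi>\<in>set L. c \<chi> * conv X \<chi> \<psi> \<one>\<^bsub>X\<^esub>) = conv X (\<lambda>x. \<Sum>\<chi>\<in>set L. c \<chi> * \<chi> x) \<psi> \<one>\<^bsub>X\<^esub>"
      by (rule conv_sum_left[symmetric])
    also have "\<dots> = conv X (\<lambda>x. of_nat (Coset.order X) * (if x = \<one>\<^bsub>X\<^esub> then 1 else 0)) \<psi> \<one>\<^bsub>X\<^esub>"
      by (rule conv_cong[OF X(1)]) (use reg in auto)
    also have "\<dots> = of_nat (Coset.order X) * \<psi> \<one>\<^bsub>X\<^esub>"
      unfolding conv_scale_left using conv_one_left[OF X, of "\<one>\<^bsub>X\<^esub>" \<psi>] by simp
    finally have 1: "(\<Sum>\<chi>\<in>set L. c \<chi> * conv X \<chi> \<psi> \<one>\<^bsub>X\<^esub>) = of_nat (Coset.order X) * \<psi> \<one>\<^bsub>X\<^esub>" .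
    have "(\<Sum>\<chi>\<in>set L. c \<chi> * conv X \<chi> \<psi> \<one>\<^bsub>X\<^esub>) =
        (\<Sum>\<chi>\<in>set L. if \<chi> = \<psi> then c \<psi> * of_nat (Coset.order X) else 0)"
    proof (rule sum.cong[OF refl])
      fix \<chi> assume "\<chi> \<in> set L"
      then show "c \<chi> * conv X \<chi> \<psi> \<one>\<^bsub>X\<^esub> = (if \<chi> = \<psi> then c \<psi> * of_nat (Coset.order X) else 0)"
        using conv_Irr[OF X _ \<psi>, of \<chi> "\<one>\<^bsub>X\<^esub>"] L(1) Irr_one_nonzero[OF \<psi> X(1)] by auto
    qed
    also have "\<dots> = (if \<psi> \<in> set L then c \<psi> * of_nat (Coset.order X) else 0)" by simp
    finally show ?thesis
      using 1 N Irr_one_nonzero[OF \<psi> X(1)] by (auto split: if_splits)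
  qed
  then have IL: "Irr X = set L" using L(1) by auto
  show "finite (Irr X)" by (simp add: IL)
  show "(\<Sum>\<chi>\<in>Irr X. \<chi> \<one>\<^bsub>X\<^esub> * \<chi> x) = (if x = \<one>\<^bsub>X\<^esub> then of_nat (Coset.order X) else 0)"
    if "x \<in> carrier X" for x
  proof -
    have "(\<Sum>\<chi>\<in>Irr X. \<chi> \<one>\<^bsub>X\<^esub> * \<chi> x) = (\<Sum>\<chi>\<in>set L. c \<chi> * \<chi> x)"
      using * IL by (intro sum.cong) auto
    then show ?thesis using reg[OF that] by simp
  qed
qed

text \<open>A rank bound: the rows of \<open>c\<close> live in a space of dimension at most
  \<open>card T\<close>, and the columns of \<open>m\<close> act on them as a dual family of
  functionals up to the nonzero factors \<open>d\<close>, so the rows are independent.\<close>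

lemma card_le_of_matrix_factorization:
  fixes c :: "'i \<Rightarrow> 't \<Rightarrow> 'k :: field" and m :: "'t \<Rightarrow> 'i \<Rightarrow> 'k"
  assumes T: "finite T" and d: "\<And>i. i \<in> J \<Longrightarrow> d i \<noteq> 0"
    and cm: "\<And>i j. i \<in> J \<Longrightarrow> j \<in> J \<Longrightarrow> (\<Sum>s\<in>T. c i s * m s j) = (if i = j then d i else 0)"
  shows "finite J \<and> card J \<le> card T"
proof -
  interpret V: vector_space "\<lambda>(a :: 'k) (f :: 't \<Rightarrow> 'k) x. a * f x"
    by unfold_locales (auto simp: algebra_simps fun_eq_iff)
  \<comment> \<open>Cutting a row off outside \<open>T\<close> puts it into the span of the unit
    functions \<open>e s\<close> with \<open>s\<close> in \<open>T\<close>.\<close>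
  define v where "v i = (\<lambda>s. if s \<in> T then c i s else 0)" for i
  define e :: "'t \<Rightarrow> 't \<Rightarrow> 'k" where "e s = (\<lambda>x. if x = s then 1 else 0)" for s
  define l where "l j f = (\<Sum>s\<in>T. f s * m s j)" for f :: "'t \<Rightarrow> 'k" and j
  have lv: "l j (v i) = (if i = j then d i else 0)" if "i \<in> J" "j \<in> J" for i j
    unfolding l_def v_def cm[OF that, symmetric] by (intro sum.cong) auto
  have l_sum: "l j (\<Sum>f\<in>S. (\<lambda>x. u f * f x)) = (\<Sum>f\<in>S. u f * l j f)" for j u and S :: "('t \<Rightarrow> 'k) set"
  proof -
    have "(\<Sum>f\<in>S. (\<lambda>x. u f * f x)) s = (\<Sum>f\<in>S. u f * f s)" for s
      by (induction S rule: infinite_finite_induct) auto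
    then show ?thesis
      unfolding l_def by (simp add: sum_distrib_right sum_distrib_left mult.assoc sum.swap[of _ S])
  qed
  have inj: "inj_on v J"
  proof (rule inj_onI, rule ccontr)
    fix i j assume ij: "i \<in> J" "j \<in> J" "v i = v j" "i \<noteq> j"
    then show False using lv[of i i] lv[of j i] d by auto
  qed
  have "V.independent (v ` J)"
    unfolding V.independent_explicit_finite_subsets
  proof (intro allI impI ballI)
    fix S u f assume S: "S \<subseteq> v ` J" "finite S" and z: "(\<Sum>f\<in>S. (\<lambda>x. u f * f x)) = 0" and f: "f \<in> S"
    obtain j where j: "j \<in> J" "f = v j" using S f by auto
    have "(\<Sum>g\<in>S. u g * l j g) = 0"
      using l_sum[of j u S] z by (simp add: l_def)
    moreover have "(\<Sum>g\<in>S. u g * l j g) = (\<Sum>g\<in>S. if g = f then u f * d j else 0)"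
    proof (rule sum.cong[OF refl])
      fix g assume g: "g \<in> S"
      then obtain i where i: "i \<in> J" "g = v i" using S by auto
      show "u g * l j g = (if g = f then u f * d j else 0)"
        using lv[OF i(1) j(1)] lv[OF j(1) j(1)] i j by auto
    qed
    ultimately show "u f = 0" using S f d[OF j(1)] by simp
  qed
  moreover have "v ` J \<subseteq> V.span (e ` T)"
  proof safe
    fix i assume "i \<in> J"
    have "(\<Sum>s\<in>S. (\<lambda>x. c i s * e s x)) x = (if x \<in> S then c i x else 0)" if "finite S" for S x
      using that by (induction S) (auto simp: e_def)
    then have "v i = (\<Sum>s\<in>T. (\<lambda>x. c i s * e s x))"
      using T by (auto simp: v_def)
    then show "v i \<in> V.span (e ` T)"
      by (auto intro!: V.span_sum V.span_scale intro: V.span_base)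
  qed
  ultimately have "finite (v ` J) \<and> card (v ` J) \<le> card (e ` T)"
    using V.independent_span_bound T by blast
  then show ?thesis
    using inj card_image_le[OF T, of e] by (auto simp: card_image dest: finite_imageD)
qed

section \<open>Characters of subgroups\<close>

text \<open>The inclusion of the group algebra of \<open>H\<close> into that of the whole
  group.\<close>

definition extend_zero :: "'a set \<Rightarrow> ('a \<Rightarrow> complex) \<Rightarrow> 'a \<Rightarrow> complex" where
  "extend_zero H f x = (if x \<in> H then f x else 0)"

text \<open>The expression in \<open>Gamma_le\<close>. The ambient group is a parameter, so that it
  can later be a subgroup as well.\<close>

definition restr_inner :: "('a, 'b) monoid_scheme \<Rightarrow> 'a set \<Rightarrow> ('a \<Rightarrow> complex) \<Rightarrow> ('a \<Rightarrow> complex) \<Rightarrow> complex" where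
  "restr_inner G H \<chi> \<phi> = class_inner (G\<lparr>carrier := H\<rparr>) (restrict \<chi> H) \<phi>"

locale finite_group = group G for G (structure) +
  assumes fin: "finite (carrier G)"
begin

lemma finite_subgroup: "subgroup H G \<Longrightarrow> finite H"
  using fin subgroup.subset finite_subset by blast

lemma subgroup_finite_group:
  assumes "subgroup H G" shows "finite_group (G\<lparr>carrier := H\<rparr>)"
  using assms finite_subgroup by (simp add: finite_group_def finite_group_axioms_def subgroup_imp_group)

lemma order_pos: "of_nat (Coset.order G) \<noteq> (0 :: complex)"
  using order_gt_0_iff_finite fin by simp

lemma restr_inner_alt:
  assumes "subgroup H G"
  shows "restr_inner G H \<chi> \<phi> = (\<Sum>x\<in>H. \<chi> x * cnj (\<phi> x)) / of_nat (card H)"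
  by (simp add: restr_inner_def class_inner_def Coset.order_def)

lemma restr_inner_eq_0_iff:
  assumes "subgroup H G"
  shows "restr_inner G H \<chi> \<phi> = 0 \<longleftrightarrow> (\<Sum>x\<in>H. \<chi> x * cnj (\<phi> x)) = 0"
proof -
  have "card H \<noteq> 0" using finite_subgroup[OF assms] subgroup.one_closed[OF assms] by auto
  then show ?thesis by (simp add: restr_inner_alt[OF assms])
qed

text \<open>Only \<open>x\<close> in \<open>H\<close> contributes, and for those
  \<open>inv x \<otimes> g\<close> is in \<open>H\<close> exactly when \<open>g\<close> is.\<close>

lemma conv_extend_zero:
  assumes H: "subgroup H G" and g: "g \<in> carrier G"
  shows "conv G (extend_zero H f) (extend_zero H h) g
    = extend_zero H (conv (G\<lparr>carrier := H\<rparr>) f h) g"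
proof -
  have HG: "H \<subseteq> carrier G" using H by (rule subgroup.subset)
  have *: "inv x \<otimes> g \<in> H \<longleftrightarrow> g \<in> H" if "x \<in> H" for x
  proof
    assume "inv x \<otimes> g \<in> H"
    then have "x \<otimes> (inv x \<otimes> g) \<in> H" using that H by (simp add: subgroup.m_closed)
    then show "g \<in> H" using that HG g by (auto simp: m_assoc[symmetric])
  qed (use that H in \<open>simp add: subgroup.m_closed subgroup.m_inv_closed\<close>)
  have "conv G (extend_zero H f) (extend_zero H h) g
    = (\<Sum>x\<in>H. extend_zero H f x * extend_zero H h (inv x \<otimes> g))"
    unfolding conv_def by (rule sum.mono_neutral_right) (use HG fin in \<open>auto simp: extend_zero_def\<close>)
  also have "\<dots> = extend_zero H (conv (G\<lparr>carrier := H\<rparr>) f h) g"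
    using H * by (auto simp: extend_zero_def conv_def intro!: sum.cong)
  finally show ?thesis .
qed

text \<open>The convolution of the two characters is a Hermitian quasi-idempotent, so its value at
  the identity, the inner product of \<open>\<chi>\<^sub>H\<close> and \<open>\<phi>\<close> up to a factor, is a multiple of its squared \<open>L\<^sup>2\<close> norm.\<close>

lemma conv_non_constituent:
  assumes H: "subgroup H G" and \<chi>: "\<chi> \<in> Irr G" and \<phi>: "\<phi> \<in> Irr (G\<lparr>carrier := H\<rparr>)"
    and nc: "restr_inner G H \<chi> \<phi> = 0" and g: "g \<in> carrier G"
  shows "conv G \<chi> (extend_zero H \<phi>) g = 0"
proof -
  interpret H: finite_group "G\<lparr>carrier := H\<rparr>" by (rule subgroup_finite_group[OF H])
  have HG: "H \<subseteq> carrier G" using H by (rule subgroup.subset)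
  note X = is_group fin
  let ?f = "extend_zero H \<phi>"
  define k where "k = conv G \<chi> ?f"
  define a where "a = of_nat (Coset.order G) / \<chi> \<one>"
  define b where "b = of_nat (Coset.order (G\<lparr>carrier := H\<rparr>)) / \<phi> \<one>"
  have comm: "conv G \<chi> h x = conv G h \<chi> x" if "x \<in> carrier G" for h x
    by (rule conv_class_commute[OF is_group that]) (rule Irr_mult_commute[OF \<chi> is_group])
  have ff: "conv G ?f ?f x = b * ?f x" if x: "x \<in> carrier G" for x
    using conv_Irr[OF H.is_group H.fin \<phi> \<phi>, of x]
    by (auto simp: conv_extend_zero[OF H x] extend_zero_def b_def)
  have \<chi>\<chi>: "conv G \<chi> \<chi> x = a * \<chi> x" if "x \<in> carrier G" for x
    using conv_Irr[OF X \<chi> \<chi> that] by (simp add: a_def)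
  \<comment> \<open>As \<open>\<chi>\<close> is central, the square of \<open>\<chi>\<close> times
    \<open>?f\<close> is the square of \<open>\<chi>\<close> times the square of \<open>?f\<close>,
    and these contribute the factors \<open>a\<close> and \<open>b\<close>.\<close>
  have kk: "conv G k k x = a * b * k x" if x: "x \<in> carrier G" for x
  proof -
    have "conv G k k x = conv G \<chi> (conv G ?f k) x"
      unfolding k_def by (rule conv_assoc[OF X x])
    also have "\<dots> = conv G \<chi> (\<lambda>y. b * conv G ?f \<chi> y) x"
    proof (rule conv_cong[OF is_group refl _ x])
      fix y assume y: "y \<in> carrier G"
      have "conv G ?f k y = conv G ?f (conv G ?f \<chi>) y"
        unfolding k_def by (rule conv_cong[OF is_group refl _ y]) (rule comm)
      also have "\<dots> = conv G (conv G ?f ?f) \<chi> y" by (rule conv_assoc[OF X y, symmetric])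
      also have "\<dots> = conv G (\<lambda>z. b * ?f z) \<chi> y"
        by (rule conv_cong[OF is_group _ refl y]) (rule ff)
      finally show "conv G ?f k y = b * conv G ?f \<chi> y" by (simp add: conv_scale_left)
    qed
    also have "\<dots> = b * conv G \<chi> (conv G ?f \<chi>) x" by (rule conv_scale_right)
    also have "conv G \<chi> (conv G ?f \<chi>) x = conv G \<chi> (conv G \<chi> ?f) x"
      by (rule conv_cong[OF is_group refl _ x]) (rule comm[symmetric])
    also have "\<dots> = conv G (conv G \<chi> \<chi>) ?f x" by (rule conv_assoc[OF X x, symmetric])
    also have "\<dots> = conv G (\<lambda>z. a * \<chi> z) ?f x"
      by (rule conv_cong[OF is_group _ refl x]) (rule \<chi>\<chi>)
    also have "\<dots> = a * k x" by (simp add: conv_scale_left k_def)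
    finally show ?thesis by simp
  qed
  have f_inv: "?f (inv x) = cnj (?f x)" if "x \<in> carrier G" for x
  proof -
    have "inv x \<in> H \<longleftrightarrow> x \<in> H"
      using H that by (metis inv_inv subgroup.m_inv_closed)
    then show ?thesis
      using Irr_inv[OF \<phi> H.is_group H.fin, of x] H by (auto simp: extend_zero_def)
  qed
  have k_inv: "k (inv x) = cnj (k x)" if x: "x \<in> carrier G" for x
  proof -
    have c: "x \<otimes> (inv x \<otimes> y) = y" "inv x \<otimes> (x \<otimes> y) = y" if "y \<in> carrier G" for y
      using x that by (simp_all add: m_assoc[symmetric])
    \<comment> \<open>Conjugation reverses the order of the product and inverts the argument;
      centrality of \<open>\<chi>\<close> restores the order.\<close>
    have "cnj (k x) = (\<Sum>y\<in>carrier G. \<chi> (inv y) * ?f (inv (inv y \<otimes> x)))"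
      unfolding k_def conv_def using x Irr_inv[OF \<chi> X] f_inv by (simp add: cnj_sum)
    also have "\<dots> = (\<Sum>z\<in>carrier G. ?f z * \<chi> (inv z \<otimes> inv x))"
      by (rule sum.reindex_bij_witness[of _ "\<lambda>z. x \<otimes> z" "\<lambda>y. inv x \<otimes> y"])
        (use x in \<open>auto simp: inv_mult_group m_assoc c\<close>)
    also have "\<dots> = conv G ?f \<chi> (inv x)" by (simp add: conv_def)
    also have "\<dots> = k (inv x)" using comm[of "inv x"] x by (simp add: k_def)
    finally show ?thesis ..
  qed
  have "k \<one> = (\<Sum>x\<in>carrier G. \<chi> x * cnj (?f x))"
    unfolding k_def conv_def by (intro sum.cong refl) (simp add: f_inv)
  also have "\<dots> = (\<Sum>x\<in>H. \<chi> x * cnj (\<phi> x))"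
    by (rule sum.mono_neutral_cong_right) (use HG fin in \<open>auto simp: extend_zero_def\<close>)
  also have "\<dots> = 0" using nc restr_inner_eq_0_iff[OF H] by simp
  finally have k1: "k \<one> = 0" .
  \<comment> \<open>At the identity the convolution sums \<open>k x * k (inv x)\<close>, which is a
    squared modulus by \<open>k_inv\<close>; by \<open>kk\<close> it is also a multiple of
    \<open>k \<one>\<close>, which is zero.\<close>
  have "(\<Sum>x\<in>carrier G. complex_of_real ((norm (k x))\<^sup>2)) = conv G k k \<one>"
    unfolding conv_def by (intro sum.cong refl) (subst complex_norm_square, simp add: k_inv)
  also have "\<dots> = 0" by (simp add: kk k1)
  finally have "complex_of_real (\<Sum>x\<in>carrier G. (norm (k x))\<^sup>2) = 0" by simp
  then have "(\<Sum>x\<in>carrier G. (norm (k x))\<^sup>2) = 0" by (simp only: of_real_eq_0_iff)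
  then have "(norm (k g))\<^sup>2 = 0"
    using sum_nonneg_eq_0_iff[OF fin, of "\<lambda>x. (norm (k x))\<^sup>2"] g by simp
  then show ?thesis by (simp add: k_def)
qed

text \<open>Pairing the regular character of \<open>G\<close> with \<open>\<phi>\<close> over
  \<open>H\<close> sees only the identity and gives a nonzero number, so some irreducible summand
  pairs nontrivially.\<close>

lemma ex_constituent_above:
  assumes H: "subgroup H G" and \<phi>: "\<phi> \<in> Irr (G\<lparr>carrier := H\<rparr>)"
  obtains \<chi> where "\<chi> \<in> Irr G" "restr_inner G H \<chi> \<phi> \<noteq> 0"
proof -
  interpret H: finite_group "G\<lparr>carrier := H\<rparr>" by (rule subgroup_finite_group[OF H])
  have HG: "H \<subseteq> carrier G" using H by (rule subgroup.subset)
  have "(\<Sum>\<chi>\<in>Irr G. \<chi> \<one> * (\<Sum>x\<in>H. \<chi> x * cnj (\<phi> x))) = (\<Sum>x\<in>H. (\<Sum>\<chi>\<in>Irr G. \<chi> \<one> * \<chi> x) * cnj (\<phi> x))"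
    by (simp add: sum_distrib_left sum_distrib_right mult.assoc sum.swap[of _ "Irr G"])
  also have "\<dots> = (\<Sum>x\<in>H. if x = \<one> then of_nat (Coset.order G) * cnj (\<phi> \<one>) else 0)"
    using HG by (intro sum.cong refl) (auto simp: regular_character[OF is_group fin])
  also have "\<dots> = of_nat (Coset.order G) * cnj (\<phi> \<one>)"
    using finite_subgroup[OF H] subgroup.one_closed[OF H] by simp
  also have "\<dots> \<noteq> 0"
    using order_pos Irr_one_nonzero[OF \<phi> H.is_group] by simp
  finally obtain \<chi> where "\<chi> \<in> Irr G" "(\<Sum>x\<in>H. \<chi> x * cnj (\<phi> x)) \<noteq> 0"
    by (metis (mono_tags, lifting) mult_zero_right sum.neutral)
  then show thesis using that restr_inner_eq_0_iff[OF H] by blast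
qed

text \<open>The two partial sums of the regular characters of \<open>G\<close> and \<open>H\<close> are the same central
  idempotent: each of them acts as an identity on the other one.\<close>

lemma linked_block_vanishes:
  assumes H: "subgroup H G" and C: "C \<subseteq> Irr G" and D: "D \<subseteq> Irr (G\<lparr>carrier := H\<rparr>)"
    and CD: "\<And>\<chi> \<phi>. \<chi> \<in> C \<Longrightarrow> \<phi> \<in> Irr (G\<lparr>carrier := H\<rparr>) - D \<Longrightarrow> restr_inner G H \<chi> \<phi> = 0"
    and DC: "\<And>\<chi> \<phi>. \<chi> \<in> Irr G - C \<Longrightarrow> \<phi> \<in> D \<Longrightarrow> restr_inner G H \<chi> \<phi> = 0"
    and g: "g \<in> carrier G" "g \<notin> H"
  shows "(\<Sum>\<chi>\<in>C. \<chi> \<one> * \<chi> g) = 0"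
proof -
  interpret H: finite_group "G\<lparr>carrier := H\<rparr>" by (rule subgroup_finite_group[OF H])
  let ?IH = "Irr (G\<lparr>carrier := H\<rparr>)"
  note X = is_group fin
  define N where "N = (of_nat (Coset.order G) :: complex)"
  define M where "M = (of_nat (Coset.order (G\<lparr>carrier := H\<rparr>)) :: complex)"
  have NM: "N \<noteq> 0" "M \<noteq> 0" using order_pos H.order_pos by (auto simp: N_def M_def)
  \<comment> \<open>Dividing by the group orders makes the full sums over \<open>Irr\<close> the
    unit of convolution, see \<open>uu\<close> and \<open>hh\<close>.\<close>
  define u where "u C x = (\<Sum>\<chi>\<in>C. (\<chi> \<one> / N) * \<chi> x)" for C and x
  define h where "h D x = (\<Sum>\<phi>\<in>D. (\<phi> \<one> / M) * extend_zero H \<phi> x)" for D and x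
  have finI: "finite (Irr G)" "finite ?IH"
    using finite_Irr[OF X] finite_Irr[OF H.is_group H.fin] .
  have split: "(\<Sum>\<chi>\<in>S. f \<chi>) + (\<Sum>\<chi>\<in>T - S. f \<chi>) = (\<Sum>\<chi>\<in>T. f \<chi>)" if "finite T" "S \<subseteq> T"
    for f :: "_ \<Rightarrow> complex" and S T
    using sum.subset_diff[OF that(2,1), of f] by simp
  have uu: "u C x + u (Irr G - C) x = (if x = \<one> then 1 else 0)" if x: "x \<in> carrier G" for x
  proof -
    have "u C x + u (Irr G - C) x = (\<Sum>\<chi>\<in>Irr G. \<chi> \<one> * \<chi> x) / N"
      unfolding u_def split[OF finI(1) C] by (simp add: sum_divide_distrib)
    then show ?thesis using regular_character[OF X x] NM by (simp add: N_def)
  qed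
  have hh: "h D x + h (?IH - D) x = (if x = \<one> then 1 else 0)" if x: "x \<in> carrier G" for x
  proof (cases "x \<in> H")
    case True
    then have "h D x + h (?IH - D) x = (\<Sum>\<phi>\<in>?IH. \<phi> \<one> * \<phi> x) / M"
      unfolding h_def split[OF finI(2) D] by (simp add: sum_divide_distrib extend_zero_def)
    then show ?thesis
      using regular_character[OF H.is_group H.fin, of x] True NM by (simp add: M_def)
  next
    case False
    then show ?thesis using subgroup.one_closed[OF H] by (auto simp: h_def extend_zero_def)
  qed
  have zero: "conv G (u A) (h B) x = 0"
    if "\<And>\<chi> \<phi>. \<chi> \<in> A \<Longrightarrow> \<phi> \<in> B \<Longrightarrow> restr_inner G H \<chi> \<phi> = 0" "A \<subseteq> Irr G" "B \<subseteq> ?IH" "x \<in> carrier G"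
    for A B x
  proof -
    have "conv G (u A) (h B) x =
        (\<Sum>\<chi>\<in>A. (\<chi> \<one> / N) * (\<Sum>\<phi>\<in>B. (\<phi> \<one> / M) * conv G \<chi> (extend_zero H \<phi>) x))"
      unfolding u_def h_def by (simp only: conv_sum_left conv_sum_right)
    also have "\<dots> = 0"
      by (intro sum.neutral ballI) (use that in \<open>auto intro!: sum.neutral conv_non_constituent[OF H]\<close>)
    finally show ?thesis .
  qed
  \<comment> \<open>The unit is first split as \<open>h D + h (?IH - D)\<close> and then reassembled
    from \<open>u C + u (Irr G - C)\<close>. The terms dropped and added pair characters across the
    boundary, so they vanish by \<open>zero\<close>.\<close>
  have "u C g = conv G (u C) (\<lambda>x. if x = \<one> then 1 else 0) g"
    by (rule conv_one_right[OF X g(1), symmetric])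
  also have "\<dots> = conv G (u C) (\<lambda>x. h D x + h (?IH - D) x) g"
    by (rule conv_cong[OF is_group refl _ g(1)]) (simp add: hh)
  also have "\<dots> = conv G (u C) (h D) g"
    unfolding conv_add_right using zero[of C "?IH - D" g] C CD g by auto
  also have "\<dots> = conv G (\<lambda>x. u C x + u (Irr G - C) x) (h D) g"
    unfolding conv_add_left using zero[of "Irr G - C" D g] D DC g by auto
  also have "\<dots> = conv G (\<lambda>x. if x = \<one> then 1 else 0) (h D) g"
    by (rule conv_cong[OF is_group _ refl g(1)]) (simp add: uu)
  also have "\<dots> = h D g" by (rule conv_one_left[OF X g(1)])
  also have "\<dots> = 0" using g by (simp add: h_def extend_zero_def)
  finally have "u C g = 0" .
  moreover have "(\<Sum>\<chi>\<in>C. \<chi> \<one> * \<chi> g) = N * u C g"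
    using NM by (simp add: u_def sum_distrib_left)
  ultimately show ?thesis by simp
qed

lemma Irr_restrict_sum:
  assumes H: "subgroup H G" and \<chi>: "\<chi> \<in> Irr G"
  shows "\<exists>c. \<forall>x\<in>H. \<chi> x = (\<Sum>\<theta>\<in>Irr (G\<lparr>carrier := H\<rparr>). c \<theta> * \<theta> x)"
proof -
  interpret H: finite_group "G\<lparr>carrier := H\<rparr>" by (rule subgroup_finite_group[OF H])
  have HG: "H \<subseteq> carrier G" using H by (rule subgroup.subset)
  obtain n \<rho> where r: "is_representation G n \<rho>" "\<chi> = character_of G \<rho>" using \<chi> by (rule IrrE)
  then have "is_representation (G\<lparr>carrier := H\<rparr>) n \<rho>"
    using HG by (auto simp: is_representation_iff is_group H.is_group)
  then obtain L where L: "set L \<subseteq> Irr (G\<lparr>carrier := H\<rparr>)"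
    "\<And>x. x \<in> carrier (G\<lparr>carrier := H\<rparr>) \<Longrightarrow> mat_trace (\<rho> x) = (\<Sum>\<theta>\<leftarrow>L. \<theta> x)"
    by (rule character_sum_irreducible[OF H.is_group]) blast
  show ?thesis
  proof (intro exI[of _ "\<lambda>\<theta>. of_nat (count_list L \<theta>)"] ballI)
    fix x assume x: "x \<in> H"
    have "\<chi> x = (\<Sum>\<theta>\<leftarrow>L. \<theta> x)" using L(2)[of x] x HG by (auto simp: r(2) character_of_def)
    also have "\<dots> = (\<Sum>\<theta>\<in>set L. of_nat (count_list L \<theta>) * \<theta> x)"
      by (rule sum_list_map_eq_sum_count_semiring[where f = "\<lambda>\<theta>. \<theta> x"])
    also have "\<dots> = (\<Sum>\<theta>\<in>Irr (G\<lparr>carrier := H\<rparr>). of_nat (count_list L \<theta>) * \<theta> x)"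
      by (rule sum.mono_neutral_left)
        (use L(1) finite_Irr[OF H.is_group H.fin] in \<open>auto simp: count_list_0_iff\<close>)
    finally show "\<chi> x = \<dots>" .
  qed
qed

section \<open>Central characters\<close>

text \<open>By Schur, \<open>z\<close> acts as a scalar; evaluating at \<open>\<one>\<close>
  identifies that scalar as \<open>\<chi> z / \<chi> \<one>\<close>.\<close>

lemma Irr_mult_center:
  assumes \<chi>: "\<chi> \<in> Irr G" and z: "z \<in> group_center G" and x: "x \<in> carrier G"
  shows "\<chi> (x \<otimes> z) = \<chi> z / \<chi> \<one> * \<chi> x"
proof -
  obtain n \<rho> where r: "irreducible_representation G n \<rho>" "is_representation G n \<rho>"
    "\<chi> = character_of G \<rho>" using \<chi> by (rule IrrE)
  have zG: "z \<in> carrier G" and zc: "\<And>g. g \<in> carrier G \<Longrightarrow> z \<otimes> g = g \<otimes> z"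
    using z by (auto simp: group_center_def)
  note R = representation_carrier[OF r(2) is_group] and m = representation_mult[OF r(2) is_group]
  obtain c where c: "\<rho> z = c \<cdot>\<^sub>m 1\<^sub>m n"
    using Schur_scalar[OF is_group r(1) R[OF zG]] zc zG m by metis
  have *: "\<chi> (y \<otimes> z) = c * \<chi> y" if y: "y \<in> carrier G" for y
  proof -
    have "\<rho> (y \<otimes> z) = c \<cdot>\<^sub>m \<rho> y"
      using m[OF y zG] R[OF y] mult_smult_distrib[OF R[OF y] one_carrier_mat, of c] by (simp add: c)
    then show ?thesis
      using y zG R[OF y] by (simp add: r(3) character_of_def mat_trace_def sum_distrib_left)
  qed
  have "\<chi> z = c * \<chi> \<one>" using *[OF one_closed] zG by simp
  then show ?thesis using *[OF x] Irr_one_nonzero[OF \<chi> is_group] by simp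
qed

text \<open>The quotient is the central character at \<open>z\<close>. Applying
  \<open>Irr_mult_center\<close> to the product of \<open>inv z\<close> and \<open>z\<close> shows
  that its value at \<open>inv z\<close> is the inverse.\<close>

lemma Irr_center_norm:
  assumes \<chi>: "\<chi> \<in> Irr G" and z: "z \<in> group_center G"
  shows "\<chi> z / \<chi> \<one> * cnj (\<chi> z / \<chi> \<one>) = 1" "\<chi> (inv z) / \<chi> \<one> = cnj (\<chi> z / \<chi> \<one>)"
proof -
  have zG: "z \<in> carrier G" using z by (auto simp: group_center_def)
  have nz: "\<chi> \<one> \<noteq> 0" using Irr_one_nonzero[OF \<chi> is_group] .
  have "cnj (\<chi> \<one>) = \<chi> \<one>" using Irr_inv[OF \<chi> is_group fin one_closed] by simp
  then show 1: "\<chi> (inv z) / \<chi> \<one> = cnj (\<chi> z / \<chi> \<one>)"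
    using Irr_inv[OF \<chi> is_group fin zG] by simp
  have "\<chi> \<one> = \<chi> z / \<chi> \<one> * \<chi> (inv z)"
    using Irr_mult_center[OF \<chi> z, of "inv z"] zG by simp
  then have "\<chi> z / \<chi> \<one> * (\<chi> (inv z) / \<chi> \<one>) = 1" using nz by (metis divide_self times_divide_eq_right)
  then show "\<chi> z / \<chi> \<one> * cnj (\<chi> z / \<chi> \<one>) = 1" by (simp only: 1)
qed

text \<open>Translating the summation variable by \<open>z\<close> multiplies the inner product by
  \<open>?a * cnj ?b\<close>. As it is nonzero, this factor is 1, and \<open>?b\<close> has modulus
  1.\<close>

lemma constituent_central_character:
  assumes K: "subgroup K G" and \<chi>: "\<chi> \<in> Irr G" and \<psi>: "\<psi> \<in> Irr (G\<lparr>carrier := K\<rparr>)"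
    and c: "restr_inner G K \<chi> \<psi> \<noteq> 0" and z: "z \<in> K" "z \<in> group_center G"
  shows "\<chi> z / \<chi> \<one> = \<psi> z / \<psi> \<one>"
proof -
  interpret K: finite_group "G\<lparr>carrier := K\<rparr>" by (rule subgroup_finite_group[OF K])
  have KG: "K \<subseteq> carrier G" using K by (rule subgroup.subset)
  have zK: "z \<in> group_center (G\<lparr>carrier := K\<rparr>)" using z KG by (auto simp: group_center_def)
  let ?S = "\<Sum>x\<in>K. \<chi> x * cnj (\<psi> x)"
  let ?a = "\<chi> z / \<chi> \<one>" and ?b = "\<psi> z / \<psi> \<one>"
  have "?S = (\<Sum>x\<in>K. \<chi> (x \<otimes> z) * cnj (\<psi> (x \<otimes> z)))"
    by (rule sum.reindex_bij_witness[of _ "\<lambda>x. x \<otimes> z" "\<lambda>x. x \<otimes> inv z"])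
      (use K z KG in \<open>auto simp: subgroup.m_closed subgroup.m_inv_closed m_assoc subset_iff\<close>)
  also have "\<dots> = (\<Sum>x\<in>K. (?a * cnj ?b) * (\<chi> x * cnj (\<psi> x)))"
  proof (rule sum.cong[OF refl])
    fix x assume x: "x \<in> K"
    have "\<psi> (x \<otimes> z) = ?b * \<psi> x"
      using K.Irr_mult_center[OF \<psi> zK, of x] x by simp
    moreover have "\<chi> (x \<otimes> z) = ?a * \<chi> x"
      using Irr_mult_center[OF \<chi> z(2), of x] x KG by auto
    ultimately show "\<chi> (x \<otimes> z) * cnj (\<psi> (x \<otimes> z)) = (?a * cnj ?b) * (\<chi> x * cnj (\<psi> x))"
      by (simp only: complex_cnj_mult mult_ac)
  qed
  also have "\<dots> = (?a * cnj ?b) * ?S" by (simp only: sum_distrib_left)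
  finally have "?a * cnj ?b = 1" using c restr_inner_eq_0_iff[OF K] by (metis mult_cancel_right1)
  moreover have "?b * cnj ?b = 1" using K.Irr_center_norm(1)[OF \<psi> zK] by simp
  ultimately show ?thesis by (metis mult_right_cancel mult_zero_right zero_neq_one)
qed

end

section \<open>Normal subgroups of a p-group and the center\<close>

context finite_group
begin

text \<open>The class equation on \<open>N\<close>: conjugation orbits have \<open>p\<close>-power
  size, and those of size 1 are central elements. If only \<open>\<one>\<close> were central,
  \<open>card N\<close> would be 1 modulo \<open>p\<close>, although it is a positive power of
  \<open>p\<close>.\<close>

lemma normal_p_subgroup_meets_center:
  assumes p: "prime (p :: nat)" and ord: "Coset.order G = p ^ n"
    and N: "subgroup N G" "\<And>g x. g \<in> carrier G \<Longrightarrow> x \<in> N \<Longrightarrow> g \<otimes> x \<otimes> inv g \<in> N"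
    and ne: "N \<noteq> {\<one>}"
  shows "N \<inter> group_center G \<noteq> {\<one>}"
proof
  assume trivial: "N \<inter> group_center G = {\<one>}"
  let ?\<phi> = "\<lambda>g. \<lambda>h\<in>carrier G. g \<otimes> h \<otimes> inv g"
  interpret A: group_action G "carrier G" ?\<phi> by (rule action_by_conjugation)
  have NG: "N \<subseteq> carrier G" and N1: "\<one> \<in> N" and finN: "finite N"
    using N(1) subgroup.subset subgroup.one_closed finite_subgroup by blast+
  define Orbs where "Orbs = orbit G ?\<phi> ` N"
  have orb: "orbit G ?\<phi> x = {g \<otimes> x \<otimes> inv g | g. g \<in> carrier G}" if "x \<in> N" for x
    using that NG by (auto simp: orbit_def)
  have self: "x \<in> orbit G ?\<phi> x" if "x \<in> N" for x
    using A.orbit_refl that NG by auto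
  have orbN: "orbit G ?\<phi> x \<subseteq> N" if "x \<in> N" for x
    using orb[OF that] N(2) that by auto
  have UO: "\<Union>Orbs = N" using self orbN by (auto simp: Orbs_def)
  have disj: "pairwise disjnt Orbs"
    unfolding pairwise_def disjnt_def
    using A.disjoint_union NG by (auto simp: Orbs_def orbits_def)
  have finO: "finite Orbs" "\<And>S. S \<in> Orbs \<Longrightarrow> finite S"
    using finN orbN by (auto simp: Orbs_def intro: finite_subset)
  have cardN: "card N = (\<Sum>S\<in>Orbs. card S)"
    using card_Union_disjoint[OF disj finO(2)] UO by simp
  have orb1: "orbit G ?\<phi> \<one> = {\<one>}" unfolding orb[OF N1] by (auto intro!: exI[of _ \<one>])
  then have O1: "{\<one>} \<in> Orbs" using N1 by (force simp: Orbs_def)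
  have p_dvd: "p dvd card S" if S: "S \<in> Orbs - {{\<one>}}" for S
  proof -
    obtain x where x: "x \<in> N" "S = orbit G ?\<phi> x" using S by (auto simp: Orbs_def)
    have x1: "x \<noteq> \<one>" using S x orb1 by auto
    have "x \<in> carrier G" using x NG by auto
    from A.orbit_stabilizer_theorem[OF this] have "card S dvd p ^ n"
      unfolding x(2) ord by (rule dvdI[OF sym])
    then obtain i where i: "card S = p ^ i" using divides_primepow_nat[OF p] by auto
    have "card S \<noteq> 1"
    proof
      assume "card S = 1"
      then have Sx: "S = {x}" using self[OF x(1)] x(2) by (metis card_1_singletonE singletonD)
      have "x \<otimes> g = g \<otimes> x" if g: "g \<in> carrier G" for g
      proof -
        have "g \<otimes> x \<otimes> inv g = x" using Sx x orb[OF x(1)] g by auto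
        then show ?thesis using g x NG inv_solve_right'[of x "g \<otimes> x" g] by (auto simp: subset_iff)
      qed
      then have "x \<in> N \<inter> group_center G" using x NG by (auto simp: group_center_def)
      with trivial x1 show False by auto
    qed
    then have "i \<noteq> 0" using i by auto
    then show ?thesis using i by simp
  qed
  have "card N dvd p ^ n" using lagrange[OF N(1)] ord by (metis dvd_triv_right)
  then obtain j where j: "card N = p ^ j" using divides_primepow_nat[OF p] by auto
  have "card N \<noteq> 1" using ne N1 by (metis card_1_singletonE singletonD)
  then have "j \<noteq> 0" using j by auto
  then have "p dvd card N" using j by simp
  moreover have "card N = 1 + (\<Sum>S\<in>Orbs - {{\<one>}}. card S)"
    using cardN sum.remove[OF finO(1) O1, of card] by simp
  moreover have "p dvd (\<Sum>S\<in>Orbs - {{\<one>}}. card S)"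
    using p_dvd by (intro dvd_sum) auto
  ultimately have "p dvd 1" by (metis dvd_add_left_iff)
  then show False using p not_prime_unit by blast
qed

lemma group_center_inv: "z \<in> group_center G \<Longrightarrow> inv z \<in> group_center G"
proof -
  assume z: "z \<in> group_center G"
  then have zG: "z \<in> carrier G" by (simp add: group_center_def)
  have "inv z \<otimes> g = g \<otimes> inv z" if g: "g \<in> carrier G" for g
  proof -
    have "inv z \<otimes> g = inv z \<otimes> (g \<otimes> z) \<otimes> inv z" using zG g by (simp add: m_assoc)
    also have "g \<otimes> z = z \<otimes> g" using z g by (simp add: group_center_def)
    also have "inv z \<otimes> (z \<otimes> g) = g" using zG g by (simp add: m_assoc[symmetric])
    finally show ?thesis .
  qed
  then show ?thesis using zG by (simp add: group_center_def)
qed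

end

section \<open>The components of the poset\<close>

locale finite_p_group = finite_group +
  fixes p e n :: nat
  assumes p: "prime p" and order_eq: "Coset.order G = p ^ n" and order_dvd: "p ^ (e + 1) dvd Coset.order G"
begin

section \<open>Subgroups of order \<open>p ^ (e + 1)\<close> and their intersection\<close>

abbreviation "I \<equiv> subgroups_inter p e G"

lemma ex_small_subgroup:
  assumes "subgroup H G" "card H > p ^ e"
  obtains K where "subgroup K G" "card K = p ^ (e + 1)" "K \<subseteq> H"
proof -
  interpret H: finite_group "G\<lparr>carrier := H\<rparr>" by (rule subgroup_finite_group[OF assms(1)])
  have "card H dvd p ^ n" using lagrange[OF assms(1)] order_eq by (metis dvd_triv_right)
  then obtain j where j: "card H = p ^ j" using divides_primepow_nat[OF p] by auto
  have "e < j"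
    using assms(2) j prime_gt_1_nat[OF p] power_strict_increasing_iff by metis
  then have E: "(e + 1) + (j - (e + 1)) = j" by simp
  \<comment> \<open>The cofactor in \<open>sylow_thm\<close> may itself be divisible by
    \<open>p\<close>, which yields subgroups of smaller \<open>p\<close>-power order as
    well.\<close>
  have "Coset.order (G\<lparr>carrier := H\<rparr>) = p ^ (e + 1) * p ^ (j - (e + 1))"
    using power_add[of p "e + 1" "j - (e + 1)"] j unfolding E Coset.order_def by simp
  from sylow_thm[OF p H.is_group this H.fin] obtain K where
    K: "subgroup K (G\<lparr>carrier := H\<rparr>)" "card K = p ^ (e + 1)" by blast
  have "K \<subseteq> H" using subgroup.subset[OF K(1)] by simp
  then show thesis using that incl_subgroup[OF assms(1) K(1)] K(2) by blast
qed

lemma carrier_card: "card (carrier G) > p ^ e"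
proof -
  have "p ^ (e + 1) \<le> Coset.order G"
    using order_dvd order_eq p by (metis dvd_imp_le prime_gt_0_nat zero_less_power)
  moreover have "p ^ e < p ^ (e + 1)"
    using prime_gt_1_nat[OF p] by simp
  ultimately show ?thesis unfolding Coset.order_def by (rule less_le_trans[rotated])
qed

lemma I_subgroup: "subgroup I G"
  unfolding subgroups_inter_def
proof (rule subgroups_Inter)
  \<comment> \<open>The intersection of an empty family would be the whole type.\<close>
  show "{H. subgroup H G \<and> card H = p ^ (e + 1)} \<noteq> {}"
    using ex_small_subgroup[OF subgroup_self carrier_card] by blast
qed auto

text \<open>\<open>H\<close> contains a subgroup of order \<open>p ^ (e + 1)\<close>, and that one
  contains \<open>I\<close>.\<close>

lemma large_p_subgroupsD:
  assumes "H \<in> large_p_subgroups p e G"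
  shows "subgroup H G" "I \<subseteq> H"
proof -
  show H: "subgroup H G" using assms by (simp add: large_p_subgroups_def)
  obtain K where "subgroup K G" "card K = p ^ (e + 1)" "K \<subseteq> H"
    using ex_small_subgroup[OF H] assms by (auto simp: large_p_subgroups_def)
  then show "I \<subseteq> H" by (auto simp: subgroups_inter_def)
qed

lemma large_p_subgroupsI:
  assumes "subgroup H G" "card H = p ^ j" "card H > p ^ e"
  shows "H \<in> large_p_subgroups p e G"
  using assms finite_subgroup[OF assms(1)] subgroup_imp_group[OF assms(1)]
  by (auto simp: large_p_subgroups_def is_p_group_def Coset.order_def)

lemma carrier_large: "carrier G \<in> large_p_subgroups p e G"
  by (rule large_p_subgroupsI[OF subgroup_self, of n])
    (use order_eq carrier_card in \<open>auto simp: Coset.order_def\<close>)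

text \<open>Conjugation permutes the subgroups of order \<open>p ^ (e + 1)\<close>. Membership of
  \<open>x\<close> in the conjugate of \<open>H\<close> by \<open>inv g\<close> moves
  \<open>x\<close> back into \<open>H\<close>.\<close>

lemma I_conj:
  assumes g: "g \<in> carrier G" and x: "x \<in> I"
  shows "g \<otimes> x \<otimes> inv g \<in> I"
  unfolding subgroups_inter_def
proof safe
  fix H assume H: "subgroup H G" "card H = p ^ (e + 1)"
  have HG: "H \<subseteq> carrier G" using H(1) by (rule subgroup.subset)
  have cancel: "g \<otimes> (inv g \<otimes> y) = y" if "y \<in> carrier G" for y
    using g that by (simp add: m_assoc[symmetric])
  let ?c = "\<lambda>h. inv g \<otimes> h \<otimes> g"
  have "subgroup (?c ` H) G"
  proof (rule subgroupI)
    show "?c ` H \<noteq> {}" using subgroup.one_closed[OF H(1)] by auto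
    show "?c ` H \<subseteq> carrier G" using g HG by auto
  next
    fix a assume "a \<in> ?c ` H"
    then obtain h where h: "h \<in> H" "a = ?c h" by auto
    then have "inv a = ?c (inv h)" using g HG by (auto simp: inv_mult_group m_assoc subset_iff)
    then show "inv a \<in> ?c ` H" using h H(1) by (auto simp: subgroup.m_inv_closed)
  next
    fix a b assume "a \<in> ?c ` H" "b \<in> ?c ` H"
    then obtain h k where h: "h \<in> H" "a = ?c h" and k: "k \<in> H" "b = ?c k" by auto
    have hk: "h \<in> carrier G" "k \<in> carrier G" using h k HG by auto
    have "a \<otimes> b = ?c (h \<otimes> k)" using hk g by (simp add: h k m_assoc cancel)
    then show "a \<otimes> b \<in> ?c ` H" using h k H(1) by (auto simp: subgroup.m_closed)
  qed
  moreover have "card (?c ` H) = p ^ (e + 1)"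
    using card_image[of ?c H] H(2) g HG by (auto simp: inj_on_def subset_iff)
  ultimately have "x \<in> ?c ` H" using x by (auto simp: subgroups_inter_def)
  then obtain h where h: "h \<in> H" "x = ?c h" by auto
  have "g \<otimes> x \<otimes> inv g = h"
    using h HG g by (simp add: m_assoc cancel subset_iff)
  then show "g \<otimes> x \<otimes> inv g \<in> H" using h by simp
qed

section \<open>Links in the poset and its top layer\<close>

lemma GammaI: "H \<in> large_p_subgroups p e G \<Longrightarrow> \<phi> \<in> Irr (G\<lparr>carrier := H\<rparr>) \<Longrightarrow> (H, \<phi>) \<in> Gamma p e G"
  by (simp add: Gamma_def)

lemma GammaE:
  assumes "a \<in> Gamma p e G"
  obtains H \<phi> where "a = (H, \<phi>)" "H \<in> large_p_subgroups p e G" "\<phi> \<in> Irr (G\<lparr>carrier := H\<rparr>)"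
  using assms by (auto simp: Gamma_def)

lemma top_Gamma: "\<chi> \<in> Irr G \<Longrightarrow> (carrier G, \<chi>) \<in> Gamma p e G"
  using carrier_large by (intro GammaI) auto

lemma equiv_Gamma_linked: "equiv (Gamma p e G) (Gamma_linked p e G)"
proof (rule equivI)
  show "Gamma_linked p e G \<subseteq> Gamma p e G \<times> Gamma p e G" by (auto simp: Gamma_linked_def)
  show "refl_on (Gamma p e G) (Gamma_linked p e G)" by (auto simp: refl_on_def Gamma_linked_def)
  have "sym (Gamma_comparable p e G)" by (auto simp: sym_def Gamma_comparable_def)
  then have "sym ((Gamma_comparable p e G)\<^sup>*)" by (rule sym_rtrancl)
  then show "sym (Gamma_linked p e G)" by (auto simp: sym_def Gamma_linked_def)
  show "trans (Gamma_linked p e G)" by (auto simp: trans_def Gamma_linked_def intro: rtrancl_trans)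
qed

lemma constituent_linked:
  assumes H: "H \<in> large_p_subgroups p e G" and \<chi>: "\<chi> \<in> Irr G" and \<phi>: "\<phi> \<in> Irr (G\<lparr>carrier := H\<rparr>)"
    and nz: "restr_inner G H \<chi> \<phi> \<noteq> 0"
  shows "((H, \<phi>), (carrier G, \<chi>)) \<in> Gamma_linked p e G"
proof -
  have "H \<subseteq> carrier G" using large_p_subgroupsD(1)[OF H] by (rule subgroup.subset)
  then have "Gamma_le G (H, \<phi>) (carrier G, \<chi>)" using nz by (simp add: Gamma_le_def restr_inner_def)
  then show ?thesis
    using GammaI[OF H \<phi>] top_Gamma[OF \<chi>]
    by (auto simp: Gamma_linked_def Gamma_comparable_def)
qed

definition component :: "('a \<Rightarrow> complex) \<Rightarrow> ('a set \<times> ('a \<Rightarrow> complex)) set" where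
  "component \<chi> = Gamma_linked p e G `` {(carrier G, \<chi>)}"

text \<open>By \<open>ex_constituent_above\<close> every pair is linked to one at
  \<open>carrier G\<close>, so no component is missed by the characters of \<open>G\<close>.\<close>

lemma pi0_eq: "pi0_Gamma p e G = component ` Irr G"
proof
  show "component ` Irr G \<subseteq> pi0_Gamma p e G"
    using top_Gamma by (auto simp: component_def pi0_Gamma_def intro: quotientI)
  show "pi0_Gamma p e G \<subseteq> component ` Irr G"
  proof
    fix P assume "P \<in> pi0_Gamma p e G"
    then obtain a where a: "a \<in> Gamma p e G" "P = Gamma_linked p e G `` {a}"
      by (auto simp: pi0_Gamma_def elim: quotientE)
    from a(1) obtain H \<phi> where H: "a = (H, \<phi>)" "H \<in> large_p_subgroups p e G" "\<phi> \<in> Irr (G\<lparr>carrier := H\<rparr>)"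
      by (rule GammaE)
    obtain \<chi> where \<chi>: "\<chi> \<in> Irr G" "restr_inner G H \<chi> \<phi> \<noteq> 0"
      using ex_constituent_above[OF large_p_subgroupsD(1)[OF H(2)] H(3)] by blast
    have "P = component \<chi>"
      using equiv_class_eq[OF equiv_Gamma_linked constituent_linked[OF H(2) \<chi>(1) H(3) \<chi>(2)]] a H
      by (simp add: component_def)
    then show "P \<in> component ` Irr G" using \<chi> by simp
  qed
qed

definition chars_of :: "('a set \<times> ('a \<Rightarrow> complex)) set \<Rightarrow> ('a \<Rightarrow> complex) set" where
  "chars_of P = {\<chi> \<in> Irr G. component \<chi> = P}"

lemma finite_chars_of: "finite (chars_of P)"
  using finite_Irr[OF is_group fin] by (simp add: chars_of_def)

lemma finite_pi0: "finite (pi0_Gamma p e G)"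
  using finite_Irr[OF is_group fin] by (simp add: pi0_eq)

lemma sum_chars_of:
  fixes f :: "_ \<Rightarrow> complex"
  shows "(\<Sum>P\<in>pi0_Gamma p e G. \<Sum>\<chi>\<in>chars_of P. f \<chi>) = (\<Sum>\<chi>\<in>Irr G. f \<chi>)"
  unfolding chars_of_def
  by (rule sum.group) (use finite_Irr[OF is_group fin] finite_pi0 pi0_eq in auto)

section \<open>The upper bound\<close>

lemma component_block_vanishes:
  assumes g: "g \<in> carrier G" "g \<notin> I"
  shows "(\<Sum>\<chi>\<in>chars_of P. \<chi> \<one> * \<chi> g) = 0"
proof -
  obtain H where H: "subgroup H G" "card H = p ^ (e + 1)" "g \<notin> H"
    using g(2) by (auto simp: subgroups_inter_def)
  have HL: "H \<in> large_p_subgroups p e G"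
    by (rule large_p_subgroupsI[OF H(1,2)]) (use prime_gt_1_nat[OF p] H(2) in simp)
  define D where "D = {\<phi> \<in> Irr (G\<lparr>carrier := H\<rparr>). Gamma_linked p e G `` {(H, \<phi>)} = P}"
  \<comment> \<open>A nonzero inner product would link the two pairs, so they cannot lie on
    different sides of \<open>P\<close>. The negated equivalence covers both crossing conditions of
    \<open>linked_block_vanishes\<close>.\<close>
  have *: "restr_inner G H \<chi> \<phi> = 0"
    if "\<chi> \<in> Irr G" "\<phi> \<in> Irr (G\<lparr>carrier := H\<rparr>)" "\<not> (\<chi> \<in> chars_of P \<longleftrightarrow> \<phi> \<in> D)" for \<chi> \<phi>
  proof (rule ccontr)
    assume "restr_inner G H \<chi> \<phi> \<noteq> 0"
    then have "Gamma_linked p e G `` {(H, \<phi>)} = component \<chi>"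
      unfolding component_def
      by (intro equiv_class_eq[OF equiv_Gamma_linked] constituent_linked[OF HL that(1,2)])
    then show False using that by (auto simp: chars_of_def D_def)
  qed
  show ?thesis
    by (rule linked_block_vanishes[OF H(1) _ _ _ _ g(1) H(3), of _ D])
      (use * in \<open>auto simp: chars_of_def D_def\<close>)
qed

text \<open>Independence is witnessed by a dual family: the block sum of \<open>P\<close> convolved
  with a representative \<open>r Q\<close> vanishes at \<open>\<one>\<close> unless
  \<open>P = Q\<close>. The block sum lives on \<open>I\<close>, so this pairing factors through its
  expansion in \<open>Irr\<close> of \<open>I\<close>.\<close>

lemma pi0_upper: "card (pi0_Gamma p e G) \<le> card (Irr (G\<lparr>carrier := I\<rparr>))"
proof -
  interpret GI: finite_group "G\<lparr>carrier := I\<rparr>" by (rule subgroup_finite_group[OF I_subgroup])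
  have IG: "I \<subseteq> carrier G" using I_subgroup by (rule subgroup.subset)
  let ?T = "Irr (G\<lparr>carrier := I\<rparr>)"
  have "\<forall>\<chi>. \<exists>c. \<chi> \<in> Irr G \<longrightarrow> (\<forall>x\<in>I. \<chi> x = (\<Sum>\<theta>\<in>?T. c \<theta> * \<theta> x))"
    using Irr_restrict_sum[OF I_subgroup] by blast
  then obtain a where a: "\<And>\<chi> x. \<chi> \<in> Irr G \<Longrightarrow> x \<in> I \<Longrightarrow> \<chi> x = (\<Sum>\<theta>\<in>?T. a \<chi> \<theta> * \<theta> x)"
    by metis
  have "\<forall>P\<in>pi0_Gamma p e G. \<exists>\<chi>. \<chi> \<in> chars_of P" by (auto simp: pi0_eq chars_of_def)
  then obtain r where r: "\<And>P. P \<in> pi0_Gamma p e G \<Longrightarrow> r P \<in> chars_of P" by metis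
  then have rI: "r P \<in> Irr G" if "P \<in> pi0_Gamma p e G" for P using that by (auto simp: chars_of_def)
  \<comment> \<open>\<open>c P\<close> are the coefficients of the restricted block sum of
    \<open>P\<close> in the characters of \<open>I\<close>; \<open>m\<close> below is the pairing
    with \<open>r Q\<close> over \<open>I\<close>.\<close>
  define c where "c P \<theta> = (\<Sum>\<chi>\<in>chars_of P. \<chi> \<one> * a \<chi> \<theta>)" for P \<theta>
  define m where "m \<theta> Q = (\<Sum>x\<in>I. \<theta> x * r Q (inv x))" for \<theta> Q
  have "(\<Sum>\<theta>\<in>?T. c P \<theta> * m \<theta> Q) = (if P = Q then of_nat (Coset.order G) * r P \<one> else 0)"
    if PQ: "P \<in> pi0_Gamma p e G" "Q \<in> pi0_Gamma p e G" for P Q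
  proof -
    let ?u = "\<lambda>x. \<Sum>\<chi>\<in>chars_of P. \<chi> \<one> * \<chi> x"
    have "(\<Sum>\<theta>\<in>?T. c P \<theta> * m \<theta> Q) = (\<Sum>x\<in>I. (\<Sum>\<theta>\<in>?T. c P \<theta> * \<theta> x) * r Q (inv x))"
      unfolding m_def by (simp add: sum_distrib_left sum_distrib_right mult.assoc sum.swap[of _ I])
    also have "\<dots> = (\<Sum>x\<in>I. ?u x * r Q (inv x))"
    proof (rule sum.cong[OF refl])
      fix x assume x: "x \<in> I"
      have "(\<Sum>\<theta>\<in>?T. c P \<theta> * \<theta> x) = (\<Sum>\<chi>\<in>chars_of P. \<chi> \<one> * (\<Sum>\<theta>\<in>?T. a \<chi> \<theta> * \<theta> x))"
        unfolding c_def
        by (simp add: sum_distrib_left sum_distrib_right mult.assoc sum.swap[of _ "chars_of P"])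
      also have "\<dots> = ?u x"
        by (rule sum.cong[OF refl]) (use a x in \<open>auto simp: chars_of_def\<close>)
      finally show "(\<Sum>\<theta>\<in>?T. c P \<theta> * \<theta> x) * r Q (inv x) = ?u x * r Q (inv x)" by simp
    qed
    \<comment> \<open>The vanishing outside \<open>I\<close> enters here: it extends the sum to all
      of \<open>G\<close>, where orthogonality of characters of \<open>G\<close> applies.\<close>
    also have "\<dots> = (\<Sum>x\<in>carrier G. ?u x * r Q (inv x))"
      by (rule sum.mono_neutral_left) (use fin IG component_block_vanishes in auto)
    also have "\<dots> = conv G ?u (r Q) \<one>"
      unfolding conv_def by (intro sum.cong refl) simp
    also have "\<dots> = (\<Sum>\<chi>\<in>chars_of P. \<chi> \<one> * conv G \<chi> (r Q) \<one>)" by (rule conv_sum_left)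
    also have "\<dots> = (\<Sum>\<chi>\<in>chars_of P. if \<chi> = r Q then of_nat (Coset.order G) * r Q \<one> else 0)"
    proof (rule sum.cong[OF refl])
      fix \<chi> assume "\<chi> \<in> chars_of P"
      then have "\<chi> \<in> Irr G" by (simp add: chars_of_def)
      then show "\<chi> \<one> * conv G \<chi> (r Q) \<one> = (if \<chi> = r Q then of_nat (Coset.order G) * r Q \<one> else 0)"
        using conv_Irr[OF is_group fin _ rI[OF PQ(2)], of \<chi> \<one>] Irr_one_nonzero[OF _ is_group, of \<chi>]
        by simp
    qed
    \<comment> \<open>A character has a single component, so \<open>r Q\<close> is in
      \<open>chars_of P\<close> only for \<open>P = Q\<close>.\<close>
    also have "\<dots> = (if P = Q then of_nat (Coset.order G) * r P \<one> else 0)"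
      using r[OF PQ(1)] r[OF PQ(2)] finite_chars_of by (auto simp: chars_of_def)
    finally show ?thesis .
  qed
  moreover have "of_nat (Coset.order G) * r P \<one> \<noteq> 0" if "P \<in> pi0_Gamma p e G" for P
    using order_pos Irr_one_nonzero[OF rI[OF that] is_group] by simp
  ultimately show ?thesis
    using card_le_of_matrix_factorization[of ?T "pi0_Gamma p e G" "\<lambda>P. of_nat (Coset.order G) * r P \<one>" c m]
      finite_Irr[OF GI.is_group GI.fin] by blast
qed

section \<open>The lower bound\<close>

lemma Gamma_le_central_character:
  assumes a: "a \<in> Gamma p e G" and b: "b \<in> Gamma p e G" and le: "Gamma_le G a b"
    and z: "z \<in> I" "z \<in> group_center G"
  shows "snd a z / snd a \<one> = snd b z / snd b \<one>"
proof -
  obtain K \<psi> where K: "a = (K, \<psi>)" "K \<in> large_p_subgroups p e G" "\<psi> \<in> Irr (G\<lparr>carrier := K\<rparr>)"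
    using a by (rule GammaE)
  obtain H \<phi> where H: "b = (H, \<phi>)" "H \<in> large_p_subgroups p e G" "\<phi> \<in> Irr (G\<lparr>carrier := H\<rparr>)"
    using b by (rule GammaE)
  note sub = large_p_subgroupsD[OF K(2)] large_p_subgroupsD[OF H(2)]
  \<comment> \<open>The comparison of \<open>\<psi>\<close> with \<open>\<phi>\<close> takes place
    inside \<open>H\<close>, so the lemma on central characters is used with \<open>H\<close> as
    ambient group; \<open>z\<close> lies in \<open>K\<close> and \<open>H\<close> because it lies in
    \<open>I\<close>.\<close>
  interpret H: finite_group "G\<lparr>carrier := H\<rparr>" by (rule subgroup_finite_group[OF sub(3)])
  have KH: "K \<subseteq> H" and nz: "restr_inner (G\<lparr>carrier := H\<rparr>) K \<phi> \<psi> \<noteq> 0"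
    using le by (auto simp: Gamma_le_def K H restr_inner_def)
  have "subgroup K (G\<lparr>carrier := H\<rparr>)" by (rule subgroup_incl[OF sub(1,3) KH])
  moreover have "z \<in> group_center (G\<lparr>carrier := H\<rparr>)"
    using z sub subgroup.subset[OF sub(3)] by (auto simp: group_center_def)
  ultimately have "\<phi> z / \<phi> \<one> = \<psi> z / \<psi> \<one>"
    using H.constituent_central_character[OF _ H(3) _ nz] K(3) z sub(2) by auto
  then show ?thesis by (simp add: K H)
qed

lemma component_central_character:
  assumes \<chi>: "\<chi> \<in> Irr G" "\<psi> \<in> Irr G" "component \<chi> = component \<psi>"
    and z: "z \<in> I" "z \<in> group_center G"
  shows "\<chi> z / \<chi> \<one> = \<psi> z / \<psi> \<one>"
proof -
  have "((carrier G, \<chi>), (carrier G, \<psi>)) \<in> Gamma_linked p e G"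
    using eq_equiv_class[OF _ equiv_Gamma_linked top_Gamma[OF \<chi>(2)]] \<chi>(3) by (simp add: component_def)
  then have linked: "((carrier G, \<chi>), (carrier G, \<psi>)) \<in> (Gamma_comparable p e G)\<^sup>*"
    by (simp add: Gamma_linked_def)
  \<comment> \<open>Stated for arbitrary pairs, because a path between two characters of
    \<open>G\<close> may pass through other subgroups.\<close>
  have "snd a z / snd a \<one> = snd b z / snd b \<one>" if "(a, b) \<in> (Gamma_comparable p e G)\<^sup>*" for a b
    using that
  proof (induction rule: rtrancl_induct)
    case (step b d)
    have "b \<in> Gamma p e G" "d \<in> Gamma p e G" "Gamma_le G b d \<or> Gamma_le G d b"
      using step(2) by (auto simp: Gamma_comparable_def)
    then have "snd b z / snd b \<one> = snd d z / snd d \<one>"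
      using Gamma_le_central_character[OF _ _ _ z, of b d] Gamma_le_central_character[OF _ _ _ z, of d b]
      by argo
    with step.IH show ?case by simp
  qed simp
  from this[OF linked] show ?thesis by simp
qed

text \<open>For central \<open>y\<close> and \<open>z\<close>,
  \<open>\<chi> (y \<otimes> inv z)\<close> is \<open>\<chi> \<one> * w P y * cnj (w P z)\<close>,
  where \<open>w\<close> depends only on the component. The regular character at
  \<open>y \<otimes> inv z\<close> thus becomes a sum over components, and it is nonzero only for
  \<open>y = z\<close>.\<close>

lemma pi0_lower: "card (I \<inter> group_center G) \<le> card (pi0_Gamma p e G)"
proof -
  have "\<forall>P\<in>pi0_Gamma p e G. \<exists>\<chi>. \<chi> \<in> chars_of P" by (auto simp: pi0_eq chars_of_def)
  then obtain r where r: "\<And>P. P \<in> pi0_Gamma p e G \<Longrightarrow> r P \<in> chars_of P" by metis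
  define w where "w P z = r P z / r P \<one>" for P z
  have w: "w P z = \<chi> z / \<chi> \<one>"
    if "P \<in> pi0_Gamma p e G" "\<chi> \<in> chars_of P" "z \<in> I \<inter> group_center G" for P \<chi> z
    unfolding w_def
    using r[OF that(1)] that by (intro component_central_character) (auto simp: chars_of_def)
  \<comment> \<open>The sum of squared degrees is the weight of \<open>P\<close> in the regular
    character.\<close>
  define c where "c y P = (\<Sum>\<chi>\<in>chars_of P. \<chi> \<one> * \<chi> \<one>) * w P y" for y P
  define m where "m P z = cnj (w P z)" for P z
  have "(\<Sum>P\<in>pi0_Gamma p e G. c y P * m P z) = (if y = z then of_nat (Coset.order G) else 0)"
    if y: "y \<in> I \<inter> group_center G" and z: "z \<in> I \<inter> group_center G" for y z
  proof -
    have G: "y \<in> carrier G" "z \<in> carrier G" using y z by (auto simp: group_center_def)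
    have "(\<Sum>P\<in>pi0_Gamma p e G. c y P * m P z) =
        (\<Sum>P\<in>pi0_Gamma p e G. \<Sum>\<chi>\<in>chars_of P. \<chi> \<one> * \<chi> (y \<otimes> inv z))"
    proof (rule sum.cong[OF refl])
      fix P assume P: "P \<in> pi0_Gamma p e G"
      have "c y P * m P z = (\<Sum>\<chi>\<in>chars_of P. \<chi> \<one> * \<chi> \<one> * w P y * m P z)"
        by (simp add: c_def sum_distrib_right)
      also have "\<dots> = (\<Sum>\<chi>\<in>chars_of P. \<chi> \<one> * \<chi> (y \<otimes> inv z))"
      proof (rule sum.cong[OF refl])
        fix \<chi> assume \<chi>: "\<chi> \<in> chars_of P"
        then have \<chi>I: "\<chi> \<in> Irr G" by (simp add: chars_of_def)
        have "m P z = \<chi> (inv z) / \<chi> \<one>"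
          unfolding m_def w[OF P \<chi> z] using Irr_center_norm(2)[OF \<chi>I, of z] z by simp
        moreover have "\<chi> (y \<otimes> inv z) = \<chi> (inv z) / \<chi> \<one> * \<chi> y"
          using Irr_mult_center[OF \<chi>I group_center_inv G(1)] z by simp
        ultimately show "\<chi> \<one> * \<chi> \<one> * w P y * m P z = \<chi> \<one> * \<chi> (y \<otimes> inv z)"
          unfolding w[OF P \<chi> y] using Irr_one_nonzero[OF \<chi>I is_group] by simp
      qed
      finally show "c y P * m P z = (\<Sum>\<chi>\<in>chars_of P. \<chi> \<one> * \<chi> (y \<otimes> inv z))" .
    qed
    also have "\<dots> = (if y \<otimes> inv z = \<one> then of_nat (Coset.order G) else 0)"
      unfolding sum_chars_of using G by (intro regular_character[OF is_group fin]) simp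
    also have "y \<otimes> inv z = \<one> \<longleftrightarrow> y = z"
      using G by (metis inv_closed inv_equality inv_inv r_inv)
    finally show ?thesis .
  qed
  then show ?thesis
    using card_le_of_matrix_factorization[of "pi0_Gamma p e G" "I \<inter> group_center G"
        "\<lambda>_. of_nat (Coset.order G)" c m] finite_pi0 order_pos by blast
qed

text \<open>Distinct irreducible characters convolve to zero, but over a one-element group the
  convolution is the product of two nonzero degrees.\<close>

lemma card_Irr_trivial:
  assumes "I = {\<one>}" shows "card (Irr (G\<lparr>carrier := I\<rparr>)) \<le> 1"
proof -
  interpret GI: finite_group "G\<lparr>carrier := I\<rparr>" by (rule subgroup_finite_group[OF I_subgroup])
  have "\<chi> = \<psi>" if "\<chi> \<in> Irr (G\<lparr>carrier := I\<rparr>)" "\<psi> \<in> Irr (G\<lparr>carrier := I\<rparr>)" for \<chi> \<psi>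
  proof (rule ccontr)
    assume "\<chi> \<noteq> \<psi>"
    then have "conv (G\<lparr>carrier := I\<rparr>) \<chi> \<psi> \<one> = 0"
      using conv_Irr[OF GI.is_group GI.fin that, of \<one>] assms by simp
    then have "\<chi> \<one> * \<psi> \<one> = 0"
      using m_inv_consistent[OF I_subgroup, of \<one>] assms by (simp add: conv_def)
    then show False using Irr_one_nonzero[OF _ GI.is_group] that by fastforce
  qed
  then show ?thesis
    using card_le_Suc0_iff_eq[OF finite_Irr[OF GI.is_group GI.fin]] by auto
qed

text \<open>For trivial \<open>I\<close> the two bounds squeeze the count to 1, the lower one
  because \<open>\<one>\<close> is central. Conversely, one component makes
  \<open>I \<inter> group_center G\<close> trivial, and \<open>I_conj\<close> passes this on to
  \<open>I\<close>.\<close>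

lemma connected_iff: "Gamma_connected p e G \<longleftrightarrow> I = {\<one>}"
proof
  have one: "\<one> \<in> I \<inter> group_center G"
    using subgroup.one_closed[OF I_subgroup] by (simp add: group_center_def)
  have finI: "finite (I \<inter> group_center G)" using finite_subgroup[OF I_subgroup] by simp
  show "I = {\<one>}" if "Gamma_connected p e G"
  proof (rule ccontr)
    assume "I \<noteq> {\<one>}"
    from normal_p_subgroup_meets_center[OF p order_eq I_subgroup I_conj this]
    have "I \<inter> group_center G \<noteq> {\<one>}" .
    moreover have "card (I \<inter> group_center G) \<le> Suc 0"
      using pi0_lower that by (simp add: Gamma_connected_def)
    then have "I \<inter> group_center G = {\<one>}"
      using one card_le_Suc0_iff_eq[OF finI] by auto
    ultimately show False by simp
  qed
  show "Gamma_connected p e G" if "I = {\<one>}"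
  proof -
    have "card (I \<inter> group_center G) \<ge> 1" using one finI by (metis One_nat_def Suc_leI card_gt_0_iff empty_iff)
    then show ?thesis
      using pi0_lower pi0_upper card_Irr_trivial[OF that] by (simp add: Gamma_connected_def)
  qed
qed

end

theorem theorem2p3:
  fixes p e :: nat and G :: "('a, 'b) monoid_scheme"
  assumes "prime p"
    and "is_p_group p G"
    and "p ^ (e + 1) dvd Coset.order G"
  defines "I \<equiv> subgroups_inter p e G"
  shows "card (I \<inter> group_center G) \<le> card (pi0_Gamma p e G)
       \<and> card (pi0_Gamma p e G) \<le> card (Irr (G\<lparr>carrier := I\<rparr>))
       \<and> (Gamma_connected p e G \<longleftrightarrow> I = {\<one>\<^bsub>G\<^esub>})"
proof -
  obtain n where "Coset.order G = p ^ n" using assms(2) by (auto simp: is_p_group_def)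
  then interpret finite_p_group G p e n
    using assms by (simp add: finite_p_group_def finite_p_group_axioms_def finite_group_def
        finite_group_axioms_def is_p_group_def)
  show ?thesis unfolding I_def using pi0_lower pi0_upper connected_iff by blast
qed

end
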